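(* Let $P$ be any one of the pattern pairs $(2413,3142)$, $(2413,4213)$, $(3412,4312)$, and let $S(t)=\mathfrak{S}(P)^{\mathsf{des},\mathsf{iar},\mathsf{comp}}(t,1,1;z)-1$. Then $$\tilde{\mathfrak{S}}(P)^{\mathsf{des},\mathsf{iar},\mathsf{comp}}(t,r,p)=\frac{(1/z+1-r-p)S(t)+(1-r)(1-p)S(t)^2}{(1-rpz)(1+(1-p)S(t))(1+(1-r)S(t))},$$ where $S(t)$ satisfies the algebraic functional equation $$S(t)=z+(1+t)zS(t)+tzS(t)^2+tS(t)^3.$$
   Context: $\mathfrak{S}_n$ is the set of permutations $\pi=\pi(1)\cdots\pi(n)$ of $[n]=\{1,\dots,n\}$. A permutation $\pi\in\mathfrak{S}_n$ contains the pattern $\sigma\in\mathfrak{S}_k$ if there are $j_1<\cdots<j_k$ such that $\pi(j_a)<\pi(j_b)$ if and only if $\sigma(a)<\sigma(b)$ for all $1\le a<b\le k$; otherwise it avoids $\sigma$. For a set $P$ of patterns, $\mathfrak{S}_n(P)$ is the set of $\pi\in\mathfrak{S}_n$ avoiding every pattern in $P$. For $\pi\in\mathfrak{S}_n$: $\mathrm{DES}(\pi)=\{i\in[n-1]:\pi(i)>\pi(i+1)\}$, $\mathsf{des}(\pi)=|\mathrm{DES}(\pi)|$, $\mathsf{iar}(\pi)=\min(\mathrm{DES}(\pi)\cup\{n\})$, $\mathsf{comp}(\pi)=|\{i\in[n]:\pi(j)\le i\text{ for all }j\le i\}|$. Define the formal power series in $z$ $$\mathfrak{S}(P)^{\mathsf{des},\mathsf{iar},\mathsf{comp}}(t,r,p;z)=\sum_{n\ge0}z^n\sum_{\pi\in\mathfrak{S}_n(P)}t^{\mathsf{des}(\pi)}r^{\mathsf{iar}(\pi)}p^{\mathsf{comp}(\pi)},$$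 where the empty permutation ($n=0$) contributes $1$, and $\tilde{\mathfrak{S}}(P)^{\mathsf{des},\mathsf{iar},\mathsf{comp}}(t,r,p)=\big(\mathfrak{S}(P)^{\mathsf{des},\mathsf{iar},\mathsf{comp}}(t,r,p;z)-1\big)/(rpz)$. *)

theory Defs
  imports
    "HOL-Computational_Algebra.Computational_Algebra"
    "HOL-Combinatorics.Multiset_Permutations"
begin

text \<open>
  The permutations of \<open>[n]\<close> are the words \<open>\<pi>(1)\<dots>\<pi>(n)\<close>, i.e. the elements of
  \<open>permutations_of_set {1..n}\<close>. List indices start at 0, so the
  \<open>i\<close>-th letter is accessed through \<open>letter\<close>, with \<open>1 \<le> i \<le> n\<close>.
\<close>

definition letter :: "nat list \<Rightarrow> nat \<Rightarrow> nat" where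
  "letter \<pi> i = \<pi> ! (i - 1)"

definition contains_pattern :: "nat list \<Rightarrow> nat list \<Rightarrow> bool" where
  "contains_pattern \<pi> \<sigma> \<longleftrightarrow>
     (\<exists>j. strict_mono_on {1..length \<sigma>} j \<and> j ` {1..length \<sigma>} \<subseteq> {1..length \<pi>} \<and>
        (\<forall>a b. 1 \<le> a \<and> a < b \<and> b \<le> length \<sigma> \<longrightarrow>
           (letter \<pi> (j a) < letter \<pi> (j b) \<longleftrightarrow> letter \<sigma> a < letter \<sigma> b)))"

definition avoiders :: "nat \<Rightarrow> nat list set \<Rightarrow> nat list set" where
  "avoiders n P = {\<pi> \<in> permutations_of_set {1..n}. \<forall>\<sigma>\<in>P. \<not> contains_pattern \<pi> \<sigma>}"

definition DES :: "nat list \<Rightarrow> nat set" where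
  "DES \<pi> = {i \<in> {1..<length \<pi>}. letter \<pi> i > letter \<pi> (i + 1)}"

definition des :: "nat list \<Rightarrow> nat" where
  "des \<pi> = card (DES \<pi>)"

definition iar :: "nat list \<Rightarrow> nat" where
  "iar \<pi> = Min (DES \<pi> \<union> {length \<pi>})"

definition ncomp :: "nat list \<Rightarrow> nat" where
  "ncomp \<pi> = card {i \<in> {1..length \<pi>}. \<forall>j\<in>{1..i}. letter \<pi> j \<le> i}"

text \<open>
  The weights \<open>t\<close>, \<open>r\<close>, \<open>p\<close> are elements of the coefficient ring. Taking for that ring the
  rational functions \<open>\<rat>(t, r, p)\<close> and for the weights its indeterminates gives the generating
  function in three formal variables.
\<close>

definition gf_avoiders ::
  "nat list set \<Rightarrow> 'a \<Rightarrow> 'a \<Rightarrow> 'a \<Rightarrow> 'a::comm_ring_1 fps" where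
  "gf_avoiders P t r p =
     Abs_fps (\<lambda>n. \<Sum>\<pi>\<in>avoiders n P. t ^ des \<pi> * r ^ iar \<pi> * p ^ ncomp \<pi>)"

text \<open>
  Division by \<open>r p z\<close> takes place in the field of formal Laurent series in \<open>z\<close>; it is meaningful
  for \<open>r \<noteq> 0\<close> and \<open>p \<noteq> 0\<close>.
\<close>

definition gf_avoiders_tilde ::
  "nat list set \<Rightarrow> 'a \<Rightarrow> 'a \<Rightarrow> 'a \<Rightarrow> 'a::field fls" where
  "gf_avoiders_tilde P t r p =
     (fps_to_fls (gf_avoiders P t r p) - 1) / (fls_const r * fls_const p * fls_X)"

end

theory Submission
  imports Defs
begin

text \<open>Let \<open>F(r, p)\<close> be the generating function of the nonempty members of one of the classes,
\<open>S = F(1, 1)\<close>, and let \<open>B(r)\<close> be that of its sum-indecomposable members of length at least 2,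
without the weight \<open>p\<close>. All five patterns are sum-indecomposable, so a direct sum lies in the class
exactly if both summands do. Splitting off the first component of a permutation gives
\<open>F(r, p) = r p z (1 + F(r, p)) + p B(r) (1 + F(1, p))\<close>:
the initial ascending run ends inside the first component, unless this component is the single
letter 1 (\<open>wgf_nonempty_wt\<close>).

Hence a class enters only through \<open>B(r)\<close>, and each of the three classes satisfies
\<open>B(r) = t F(r, 1) U\<close> for a series \<open>U\<close> with \<open>U (1 + t S) = S\<close>.
These equations force the cubic equation for \<open>S\<close>, then \<open>F(r, 1) = r S / (1 + (1 - r) S)\<close> and
\<open>1 + F(1, p) = (1 + S) / (1 + (1 - p) S)\<close>, and with these the asserted formula
(\<open>schroeder_system_solution\<close>).

For separable permutations, those avoiding 2413 and 3142, the reason is classical: a separable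
permutation with at least two letters is either a direct sum or a skew sum (\<open>separable_splits\<close>).
Splitting off the last skew component, \<open>U\<close> counts skew-indecomposable permutations.

In the two other classes an indecomposable \<open>\<pi> = \<mu> 1 \<nu>\<close> is cut at its letter 1. Avoidance restricts
how the values of \<open>\<mu>\<close> and of \<open>\<nu>\<close> interleave so strongly that \<open>\<pi>\<close> can be recovered from two
independent pieces: the standardization \<open>\<alpha>\<close> of \<open>\<mu>\<close>, an arbitrary nonempty member of the class, and
the standardization \<open>\<gamma>\<close> of \<open>\<nu>\<close> preceded by the largest letter of \<open>\<mu>\<close>, an arbitrary indecomposable
member (\<open>glue_image\<close>). As \<open>des \<pi> = des \<alpha> + 1 + des (tl \<gamma>)\<close> and \<open>iar \<pi> = iar \<alpha>\<close>, here
\<open>U\<close> counts indecomposable permutations by the descents after their first letter; applying the same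
cut to the permutations counted by \<open>U\<close> yields \<open>U (1 + t S) = S\<close> (\<open>tail_equation\<close>).\<close>


section \<open>Words and the order in which their letters occur\<close>

text \<open>Avoidance is a property of two orders on the letters of a word, by size and by place of
occurrence. The second one is kept as a relation between letters, so that no index arithmetic is
needed when words are cut, shifted and concatenated. It is a strict linear order if the letters
are distinct.\<close>

primrec before :: "'a list \<Rightarrow> 'a \<Rightarrow> 'a \<Rightarrow> bool" where
  "before [] a b \<longleftrightarrow> False"
| "before (x # xs) a b \<longleftrightarrow> (x = a \<and> b \<in> set xs) \<or> before xs a b"

lemma before_in_set: "before xs a b \<Longrightarrow> a \<in> set xs \<and> b \<in> set xs"
  by (induction xs) auto

lemma before_append:
  "before (xs @ ys) a b \<longleftrightarrow> before xs a b \<or> before ys a b \<or> (a \<in> set xs \<and> b \<in> set ys)"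
proof (induction xs)
  case (Cons x xs)
  show ?case unfolding append_Cons before.simps Cons.IH set_append
    by (simp only: Un_iff list.set insert_iff) blast
qed simp

lemma before_iff_nth:
  "before xs a b \<longleftrightarrow> (\<exists>i j. i < j \<and> j < length xs \<and> xs ! i = a \<and> xs ! j = b)"
proof
  show "before xs a b \<Longrightarrow> \<exists>i j. i < j \<and> j < length xs \<and> xs ! i = a \<and> xs ! j = b"
  proof (induction xs)
    case (Cons x xs)
    show ?case
    proof (cases "before xs a b")
      case True
      then obtain i j where "i < j" "j < length xs" "xs ! i = a" "xs ! j = b"
        using Cons.IH by blast
      then show ?thesis by (intro exI[of _ "Suc i"] exI[of _ "Suc j"]) simp
    next
      case False
      then have "x = a" "b \<in> set xs" using Cons.prems by simp_all
      then obtain j where "j < length xs" "xs ! j = b" by (metis in_set_conv_nth)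
      then show ?thesis using \<open>x = a\<close> by (intro exI[of _ 0] exI[of _ "Suc j"]) simp
    qed
  qed simp
next
  assume "\<exists>i j. i < j \<and> j < length xs \<and> xs ! i = a \<and> xs ! j = b"
  then obtain i j where ij: "i < j" "j < length xs" "xs ! i = a" "xs ! j = b" by blast
  have "a \<in> set (take (Suc i) xs)"
    using ij by (simp add: take_Suc_conv_app_nth)
  moreover have "b \<in> set (drop (Suc i) xs)"
    using ij by (auto simp: in_set_conv_nth intro!: exI[of _ "j - Suc i"])
  ultimately have "before (take (Suc i) xs @ drop (Suc i) xs) a b"
    unfolding before_append by blast
  then show "before xs a b" by simp
qed

lemma before_map:
  "before (map f xs) A B \<longleftrightarrow> (\<exists>a b. A = f a \<and> B = f b \<and> before xs a b)"
proof
  assume "before (map f xs) A B"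
  then show "\<exists>a b. A = f a \<and> B = f b \<and> before xs a b"
    unfolding before_iff_nth by (metis length_map less_trans nth_map)
next
  assume "\<exists>a b. A = f a \<and> B = f b \<and> before xs a b"
  then show "before (map f xs) A B"
    unfolding before_iff_nth by (metis length_map less_trans nth_map)
qed

lemma before_nth:
  assumes "distinct xs" "i < length xs" "j < length xs"
  shows "before xs (xs ! i) (xs ! j) \<longleftrightarrow> i < j"
proof
  assume "before xs (xs ! i) (xs ! j)"
  then obtain k l where kl: "k < l" "l < length xs" "xs ! k = xs ! i" "xs ! l = xs ! j"
    unfolding before_iff_nth by blast
  then have "k = i" "l = j" using assms by (simp_all add: nth_eq_iff_index_eq)
  then show "i < j" using kl by simp
qed (use assms in \<open>auto simp only: before_iff_nth\<close>)

lemma before_trans: "distinct xs \<Longrightarrow> before xs a b \<Longrightarrow> before xs b c \<Longrightarrow> before xs a c"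
  by (induction xs) (auto dest: before_in_set)

lemma before_irrefl: "distinct xs \<Longrightarrow> \<not> before xs a a"
  by (induction xs) (auto dest: before_in_set)

lemma before_total:
  "a \<in> set xs \<Longrightarrow> b \<in> set xs \<Longrightarrow> a \<noteq> b \<Longrightarrow> before xs a b \<or> before xs b a"
  by (induction xs) auto

text \<open>For \<open>(<)\<close> and \<open>(>)\<close> these are the sum-decomposable and the skew-decomposable words. No
standardization is involved, so the notion applies to factors of permutations as well.\<close>

definition splits :: "('a \<Rightarrow> 'a \<Rightarrow> bool) \<Rightarrow> 'a list \<Rightarrow> bool" where
  "splits R xs \<longleftrightarrow>
     (\<exists>us vs. xs = us @ vs \<and> us \<noteq> [] \<and> vs \<noteq> [] \<and> (\<forall>u\<in>set us. \<forall>v\<in>set vs. R u v))"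

lemma splitsI:
  "us \<noteq> [] \<Longrightarrow> vs \<noteq> [] \<Longrightarrow> (\<And>u v. u \<in> set us \<Longrightarrow> v \<in> set vs \<Longrightarrow> R u v) \<Longrightarrow> splits R (us @ vs)"
  unfolding splits_def by blast

lemma splits_first:
  assumes "splits R xs"
  obtains us vs where "xs = us @ vs" "us \<noteq> []" "vs \<noteq> []"
    "\<And>u v. u \<in> set us \<Longrightarrow> v \<in> set vs \<Longrightarrow> R u v" "\<not> splits R us"
proof -
  define Q where "Q us vs \<longleftrightarrow> xs = us @ vs \<and> us \<noteq> [] \<and> vs \<noteq> [] \<and>
    (\<forall>u\<in>set us. \<forall>v\<in>set vs. R u v)" for us vs
  define N where "N n \<longleftrightarrow> (\<exists>us vs. Q us vs \<and> length us = n)" for n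
  have "\<exists>n. N n" using assms unfolding splits_def Q_def N_def by blast
  then have "\<exists>n. N n \<and> (\<forall>m<n. \<not> N m)" by (rule exists_least_iff[THEN iffD1])
  then obtain n where n: "N n" and least: "\<And>m. m < n \<Longrightarrow> \<not> N m" by blast
  obtain us vs where usvs: "Q us vs" "length us = n" using n unfolding N_def by blast
  have "\<not> splits R us"
  proof
    assume "splits R us"
    then obtain u1 u2 where u: "us = u1 @ u2" "u1 \<noteq> []" "u2 \<noteq> []"
      "\<forall>u\<in>set u1. \<forall>v\<in>set u2. R u v" unfolding splits_def by blast
    then have "Q u1 (u2 @ vs)" using usvs unfolding Q_def by auto
    moreover have "length u1 < n" using u usvs(2) by (cases u2) auto
    ultimately show False using least unfolding N_def by blast
  qed
  moreover have "R u v" if "u \<in> set us" "v \<in> set vs" for u v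
    using usvs(1) that unfolding Q_def by blast
  ultimately show ?thesis using usvs(1) that[of us vs] unfolding Q_def by blast
qed

lemma splits_rev: "splits R (rev xs) \<longleftrightarrow> splits (\<lambda>x y. R y x) xs"
proof -
  have "splits (\<lambda>x y. R y x) xs" if "splits R (rev xs)" for R :: "'a \<Rightarrow> 'a \<Rightarrow> bool" and xs
  proof -
    obtain us vs where *: "rev xs = us @ vs" "us \<noteq> []" "vs \<noteq> []"
      "\<forall>u\<in>set us. \<forall>v\<in>set vs. R u v" using \<open>splits R (rev xs)\<close> unfolding splits_def by blast
    have "xs = rev vs @ rev us" using *(1) by (metis rev_append rev_rev_ident)
    then show ?thesis using * by (auto intro!: splitsI)
  qed
  from this[of R xs] this[of "\<lambda>x y. R y x" "rev xs"] show ?thesis by auto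
qed

lemma splits_last:
  assumes "splits R xs"
  obtains us vs where "xs = us @ vs" "us \<noteq> []" "vs \<noteq> []"
    "\<And>u v. u \<in> set us \<Longrightarrow> v \<in> set vs \<Longrightarrow> R u v" "\<not> splits R vs"
proof -
  have "splits (\<lambda>x y. R y x) (rev xs)" using assms splits_rev[of "\<lambda>x y. R y x" xs] by simp
  then obtain us vs where *: "rev xs = us @ vs" "us \<noteq> []" "vs \<noteq> []"
    "\<And>u v. u \<in> set us \<Longrightarrow> v \<in> set vs \<Longrightarrow> R v u" "\<not> splits (\<lambda>x y. R y x) us"
    by (rule splits_first) blast
  have "xs = rev vs @ rev us" using *(1) by (metis rev_append rev_rev_ident)
  then show ?thesis using * by (intro that[of "rev vs" "rev us"]) (auto simp: splits_rev)
qed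

lemma splits_map:
  assumes "\<And>x y. x \<in> set xs \<Longrightarrow> y \<in> set xs \<Longrightarrow> R (f x) (f y) \<longleftrightarrow> R x y"
  shows "splits R (map f xs) \<longleftrightarrow> splits R xs"
proof
  assume "splits R (map f xs)"
  then obtain us vs where *: "map f xs = us @ vs" "us \<noteq> []" "vs \<noteq> []"
    "\<forall>u\<in>set us. \<forall>v\<in>set vs. R u v" unfolding splits_def by blast
  then obtain us' vs' where "xs = us' @ vs'" "us = map f us'" "vs = map f vs'"
    by (auto simp: map_eq_append_conv)
  then show "splits R xs" using * assms by (auto intro!: splitsI)
next
  assume "splits R xs"
  then obtain us vs where *: "xs = us @ vs" "us \<noteq> []" "vs \<noteq> []"
    "\<forall>u\<in>set us. \<forall>v\<in>set vs. R u v" unfolding splits_def by blast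
  then have "splits R (map f us @ map f vs)" using assms by (intro splitsI) auto
  then show "splits R (map f xs)" using * by simp
qed

lemma not_splits_singleton [simp]: "\<not> splits R [x]"
proof
  assume "splits R [x]"
  then obtain us vs where *: "[x] = us @ vs" "us \<noteq> []" "vs \<noteq> []" unfolding splits_def by blast
  then have "length us + length vs = 1" by (metis length_append length_Cons list.size(3) One_nat_def)
  then show False using * by (cases us; cases vs) simp_all
qed

lemma not_splits_less_and_greater:
  fixes xs :: "'a::order list"
  assumes "splits (<) xs" shows "\<not> splits (>) xs"
proof
  assume "splits (>) xs"
  then have "last xs < hd xs" unfolding splits_def by auto
  moreover have "hd xs < last xs" using assms unfolding splits_def by auto
  ultimately show False by simp
qed

section \<open>Permutations of an initial segment\<close>

definition perm :: "nat list \<Rightarrow> bool" where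
  "perm \<pi> \<longleftrightarrow> distinct \<pi> \<and> set \<pi> = {1..length \<pi>}"

lemma permI: "set \<pi> = {1..length \<pi>} \<Longrightarrow> perm \<pi>"
  unfolding perm_def by (simp add: card_distinct)

lemma perm_Nil [simp]: "perm []"
  by (simp add: perm_def)

lemma perm_singleton [simp]: "perm [x] \<longleftrightarrow> x = 1"
  by (auto simp: perm_def)

lemma perm_pos: "perm \<pi> \<Longrightarrow> x \<in> set \<pi> \<Longrightarrow> 0 < x \<and> x \<le> length \<pi>"
  by (auto simp: perm_def)

lemma finite_perms: "finite {\<pi>. perm \<pi> \<and> length \<pi> = n}"
  by (rule finite_subset[of _ "{xs. set xs \<subseteq> {1..n} \<and> length xs = n}"])
     (auto simp: perm_def finite_lists_length_eq)

text \<open>The set \<open>A\<close> is closed under passing to smaller positive numbers, whence it is an initial segment.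
This turns a comparison of letters, such as a split, into an exact statement about values.\<close>

lemma initial_segment_eq:
  fixes A B :: "nat set"
  assumes "A \<union> B = {1..n}" "\<And>a b. a \<in> A \<Longrightarrow> b \<in> B \<Longrightarrow> a < b"
  shows "A = {1..card A}" "B = {card A + 1..n}"
proof -
  have fin: "finite A" using assms(1) by (metis finite_Un finite_atLeastAtMost)
  obtain k where k: "A = {1..k}" "k \<le> n"
  proof (cases "A = {}")
    case True
    then show ?thesis using that[of 0] by auto
  next
    case False
    define k where "k = Max A"
    have kA: "k \<in> A" using fin False by (auto simp: k_def)
    have "A = {1..k}"
    proof (intro equalityI subsetI)
      fix a assume "a \<in> A"
      then show "a \<in> {1..k}" using fin assms(1) by (auto simp: k_def)
    next
      fix a assume "a \<in> {1..k}"
      moreover have "k \<le> n" using kA assms(1) by auto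
      ultimately have "a \<in> A \<union> B" using assms(1) by auto
      then show "a \<in> A" using assms(2)[OF kA, of a] \<open>a \<in> {1..k}\<close> by auto
    qed
    moreover have "k \<le> n" using kA assms(1) by auto
    ultimately show ?thesis using that by blast
  qed
  have "A \<inter> B = {}" using assms(2) by fastforce
  then have "B = {1..n} - A" using assms(1) by blast
  then show "A = {1..card A}" "B = {card A + 1..n}" using k by auto
qed

lemma perm_unshift:
  assumes "distinct vs" "set vs = {k + 1..k + m}"
  obtains ws where "perm ws" "vs = map ((+) k) ws"
proof
  let ?ws = "map (\<lambda>v. v - k) vs"
  have len: "length vs = m" using assms distinct_card[of vs] by simp
  have "(\<lambda>v. v - k) ` {k + 1..k + m} = {1..m}"
  proof (intro equalityI subsetI)
    fix a assume "a \<in> {1..m}"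
    then have "a = (k + a) - k" "k + a \<in> {k + 1..k + m}" by auto
    then show "a \<in> (\<lambda>v. v - k) ` {k + 1..k + m}" by blast
  qed auto
  then show "perm ?ws" using assms(2) len by (intro permI) simp
  show "vs = map ((+) k) ?ws" using assms(2) by (auto intro!: map_idI[symmetric] simp: comp_def)
qed

lemma strict_mono_on_less_iff:
  fixes f :: "nat \<Rightarrow> nat"
  assumes "strict_mono_on A f" "x \<in> A" "y \<in> A"
  shows "f x < f y \<longleftrightarrow> x < y"
  using assms strict_mono_onD[of A f x y] strict_mono_onD[of A f y x]
  by (cases x y rule: linorder_cases) auto

lemma before_map_strict_mono:
  assumes "strict_mono_on (set xs) (f :: nat \<Rightarrow> nat)" "a \<in> set xs" "b \<in> set xs"
  shows "before (map f xs) (f a) (f b) \<longleftrightarrow> before xs a b"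
proof
  assume "before (map f xs) (f a) (f b)"
  then obtain a' b' where *: "f a = f a'" "f b = f b'" "before xs a' b'"
    by (auto simp only: before_map)
  have "inj_on f (set xs)" using assms(1) by (rule strict_mono_on_imp_inj_on)
  then have "a = a'" "b = b'"
    using *(1,2) assms(2,3) before_in_set[OF *(3)] by (simp_all add: inj_on_eq_iff)
  then show "before xs a b" using *(3) by simp
next
  assume "before xs a b"
  then show "before (map f xs) (f a) (f b)"
    unfolding before_map by (intro exI[of _ a] exI[of _ b]) simp
qed

lemma splits_less_map:
  fixes f :: "nat \<Rightarrow> nat"
  assumes "strict_mono_on (set xs) f"
  shows "splits (<) (map f xs) \<longleftrightarrow> splits (<) xs"
  using strict_mono_on_less_iff[OF assms] by (intro splits_map) auto

section \<open>Descents, initial ascending runs and components of concatenations\<close>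

lemma letter_Cons_Suc: "0 < i \<Longrightarrow> letter (x # xs) (Suc i) = letter xs i"
  by (simp add: letter_def nth_Cons')

lemma DES_short [simp]: "DES [] = {}" "DES [x] = {}"
  by (auto simp: DES_def)

lemma DES_Cons: "DES (x # y # xs) = (if x > y then {1} else {}) \<union> Suc ` DES (y # xs)"
proof (intro equalityI subsetI)
  fix i assume i: "i \<in> DES (x # y # xs)"
  show "i \<in> (if x > y then {1} else {}) \<union> Suc ` DES (y # xs)"
  proof (cases "i = 1")
    case True
    then show ?thesis using i by (auto simp: DES_def letter_def)
  next
    case False
    then obtain i' where i': "i = Suc i'" "0 < i'" using i by (cases i) (auto simp: DES_def)
    then have "i' \<in> DES (y # xs)" using i by (auto simp: DES_def letter_Cons_Suc)
    then show ?thesis using i' by auto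
  qed
next
  fix i assume "i \<in> (if x > y then {1} else {}) \<union> Suc ` DES (y # xs)"
  then show "i \<in> DES (x # y # xs)"
    by (auto simp: DES_def letter_Cons_Suc split: if_splits) (auto simp: letter_def)
qed

lemma finite_DES [simp]: "finite (DES xs)"
  by (simp add: DES_def)

lemma des_simps [simp]:
  "des [] = 0" "des [x] = 0" "des (x # y # xs) = of_bool (x > y) + des (y # xs)"
proof -
  have "1 \<notin> Suc ` DES (y # xs)" by (auto simp: DES_def)
  then show "des (x # y # xs) = of_bool (x > y) + des (y # xs)"
    by (simp add: des_def DES_Cons card_image)
qed (simp_all add: des_def)

lemma iar_simps [simp]:
  "iar [] = 0" "iar [x] = 1" "iar (x # y # xs) = (if x > y then 1 else Suc (iar (y # xs)))"
proof -
  let ?D = "DES (y # xs) \<union> {length (y # xs)}"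
  have *: "Min (Suc ` ?D) = Suc (Min ?D)"
    by (subst mono_Min_commute[symmetric]) (auto intro: mono_Suc)
  have "Min ({1} \<union> Suc ` ?D) = 1" by (rule Min_eqI) auto
  with * show "iar (x # y # xs) = (if x > y then 1 else Suc (iar (y # xs)))"
    by (auto simp: iar_def DES_Cons image_Un insert_commute)
qed (simp_all add: iar_def)

lemma des_map: "strict_mono_on (set xs) f \<Longrightarrow> des (map f xs) = des xs"
proof (induction xs rule: induct_list012)
  case (3 x y zs)
  have "strict_mono_on (set (y # zs)) f" using 3(3) by (auto simp: strict_mono_on_def)
  moreover have "f y < f x \<longleftrightarrow> y < x" by (rule strict_mono_on_less_iff[OF 3(3)]) auto
  ultimately show ?case using 3 by simp
qed simp_all

lemma iar_map: "strict_mono_on (set xs) f \<Longrightarrow> iar (map f xs) = iar xs"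
proof (induction xs rule: induct_list012)
  case (3 x y zs)
  have "strict_mono_on (set (y # zs)) f" using 3(3) by (auto simp: strict_mono_on_def)
  moreover have "f y < f x \<longleftrightarrow> y < x" by (rule strict_mono_on_less_iff[OF 3(3)]) auto
  ultimately show ?case using 3 by simp
qed simp_all

lemma des_append:
  "xs \<noteq> [] \<Longrightarrow> ys \<noteq> [] \<Longrightarrow> des (xs @ ys) = des xs + of_bool (last xs > hd ys) + des ys"
proof (induction xs rule: induct_list012)
  case (2 x)
  then show ?case by (cases ys) auto
next
  case (3 x y zs)
  then show ?case by simp
qed simp

lemma iar_append_descent:
  "xs \<noteq> [] \<Longrightarrow> ys \<noteq> [] \<Longrightarrow> last xs > hd ys \<Longrightarrow> iar (xs @ ys) = iar xs"
proof (induction xs rule: induct_list012)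
  case (2 x)
  then show ?case by (cases ys) auto
next
  case (3 x y zs)
  then show ?case by simp
qed simp

text \<open>The first descent occurs inside \<open>xs\<close>, so that nothing behind \<open>xs\<close> is seen.\<close>

lemma iar_append_unsorted: "\<not> sorted xs \<Longrightarrow> iar (xs @ ys) = iar xs"
proof (induction xs rule: induct_list012)
  case (3 x y zs)
  then have "x > y \<or> \<not> sorted (y # zs)" by (simp only: sorted2 not_le) auto
  then show ?case using 3 by auto
qed simp_all

lemma iar_Cons_less: "(ys \<noteq> [] \<Longrightarrow> x < hd ys) \<Longrightarrow> iar (x # ys) = Suc (iar ys)"
  by (cases ys) simp_all

lemma des_Cons_less: "(ys \<noteq> [] \<Longrightarrow> x < hd ys) \<Longrightarrow> des (x # ys) = des ys"
  by (cases ys) simp_all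

section \<open>Direct sums\<close>

definition dsum :: "nat list \<Rightarrow> nat list \<Rightarrow> nat list" (infixr "\<oplus>" 65) where
  "\<alpha> \<oplus> \<beta> = \<alpha> @ map ((+) (length \<alpha>)) \<beta>"

lemma strict_mono_add [simp]: "strict_mono_on A ((+) (k::nat))"
  by (simp add: strict_mono_on_def)

lemma length_dsum [simp]: "length (\<alpha> \<oplus> \<beta>) = length \<alpha> + length \<beta>"
  by (simp add: dsum_def)

lemma dsum_Nil [simp]: "\<alpha> \<oplus> [] = \<alpha>"
  by (simp add: dsum_def)

lemma set_shift_perm:
  assumes "perm \<beta>"
  shows "set (map ((+) k) \<beta>) = {k + 1..k + length \<beta>}"
proof -
  have "set (map ((+) k) \<beta>) = (+) k ` {1..length \<beta>}" using assms by (simp add: perm_def)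
  also have "\<dots> = {k + 1..k + length \<beta>}" by simp
  finally show ?thesis .
qed

lemma perm_dsum:
  assumes "perm \<alpha>" "perm \<beta>"
  shows "perm (\<alpha> \<oplus> \<beta>)"
proof (rule permI)
  have "set (\<alpha> \<oplus> \<beta>) = {1..length \<alpha>} \<union> {length \<alpha> + 1..length \<alpha> + length \<beta>}"
    unfolding dsum_def set_append set_shift_perm[OF assms(2)] using assms(1) by (simp add: perm_def)
  also have "\<dots> = {1..length (\<alpha> \<oplus> \<beta>)}" by auto
  finally show "set (\<alpha> \<oplus> \<beta>) = {1..length (\<alpha> \<oplus> \<beta>)}" .
qed

lemma dsum_less:
  assumes "perm \<alpha>" "perm \<beta>" "x \<in> set \<alpha>" "y \<in> set (map ((+) (length \<alpha>)) \<beta>)"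
  shows "x < y"
  using perm_pos[OF assms(1,3)] assms(4) unfolding set_shift_perm[OF assms(2)] by simp

lemma perm_split_less:
  assumes "perm (us @ vs)" "\<And>u v. u \<in> set us \<Longrightarrow> v \<in> set vs \<Longrightarrow> u < v"
  obtains \<beta> where "perm us" "perm \<beta>" "us @ vs = us \<oplus> \<beta>"
proof -
  have dist: "distinct us" "distinct vs" using assms(1) by (auto simp: perm_def)
  have "set us \<union> set vs = {1..length us + length vs}" using assms(1) by (auto simp: perm_def)
  note seg = initial_segment_eq[OF this assms(2)]
  have "set us = {1..length us}" "set vs = {length us + 1..length us + length vs}"
    using seg dist by (simp_all add: distinct_card)
  then show ?thesis
    using that perm_unshift[OF dist(2)] unfolding dsum_def by (metis permI)
qed

lemma des_dsum:
  assumes "perm \<alpha>" "perm \<beta>"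
  shows "des (\<alpha> \<oplus> \<beta>) = des \<alpha> + des \<beta>"
proof (cases "\<alpha> = [] \<or> \<beta> = []")
  case False
  let ?\<beta> = "map ((+) (length \<alpha>)) \<beta>"
  have "last \<alpha> < hd ?\<beta>"
    using False assms by (intro dsum_less[of \<alpha> \<beta>] last_in_set hd_in_set) simp_all
  then have "des (\<alpha> @ ?\<beta>) = des \<alpha> + des ?\<beta>" using False by (subst des_append) auto
  then show ?thesis by (simp add: dsum_def des_map)
qed (auto simp: dsum_def des_map)

lemma not_sorted_if_indecomposable:
  fixes \<alpha> :: "nat list"
  assumes "distinct \<alpha>" "2 \<le> length \<alpha>" "\<not> splits (<) \<alpha>"
  shows "\<not> sorted \<alpha>"
proof
  assume "sorted \<alpha>"
  obtain x xs where x: "\<alpha> = [x] @ xs" "xs \<noteq> []"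
    using assms(2) by (cases \<alpha>) (auto simp: Suc_le_eq)
  then have "splits (<) ([x] @ xs)"
    using \<open>sorted \<alpha>\<close> assms(1) by (intro splitsI) (auto simp: less_le)
  then show False using x assms(3) by simp
qed

lemma iar_dsum_indecomposable:
  assumes "perm \<alpha>" "2 \<le> length \<alpha>" "\<not> splits (<) \<alpha>"
  shows "iar (\<alpha> \<oplus> \<beta>) = iar \<alpha>"
  unfolding dsum_def using assms
  by (intro iar_append_unsorted not_sorted_if_indecomposable) (auto simp: perm_def)

lemma iar_one_dsum:
  assumes "perm \<beta>"
  shows "iar ([1] \<oplus> \<beta>) = Suc (iar \<beta>)"
proof -
  let ?\<beta> = "map ((+) 1) \<beta>"
  have "1 < hd ?\<beta>" if "?\<beta> \<noteq> []"
    using dsum_less[of "[1]" \<beta> 1 "hd ?\<beta>"] hd_in_set[OF that] assms by simp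
  then have "iar (1 # ?\<beta>) = Suc (iar ?\<beta>)" by (intro iar_Cons_less)
  then show ?thesis by (simp add: dsum_def iar_map)
qed

lemma ncomp_eq_card_prefixes:
  "ncomp \<pi> = card {i \<in> {1..length \<pi>}. set (take i \<pi>) \<subseteq> {..i}}"
proof -
  have "(\<forall>j\<in>{1..i}. letter \<pi> j \<le> i) \<longleftrightarrow> set (take i \<pi>) \<subseteq> {..i}" if "i \<le> length \<pi>" for i
  proof -
    have "letter \<pi> ` {1..i} = (!) \<pi> ` (\<lambda>j. j - 1) ` {1..i}"
      unfolding image_image letter_def ..
    also have "(\<lambda>j. j - 1) ` {1..i} = {0..<i}"
    proof (intro equalityI subsetI)
      fix j assume "j \<in> {0..<i}"
      then have "j = Suc j - 1" "Suc j \<in> {1..i}" by auto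
      then show "j \<in> (\<lambda>j. j - 1) ` {1..i}" by blast
    qed auto
    also have "(!) \<pi> ` {0..<i} = set (take i \<pi>)" using that by (rule nth_image)
    finally have "letter \<pi> ` {1..i} = set (take i \<pi>)" .
    moreover have "(\<forall>j\<in>{1..i}. letter \<pi> j \<le> i) \<longleftrightarrow> letter \<pi> ` {1..i} \<subseteq> {..i}"
      by (simp only: image_subset_iff atMost_iff)
    ultimately show ?thesis by simp
  qed
  then have "{i \<in> {1..length \<pi>}. \<forall>j\<in>{1..i}. letter \<pi> j \<le> i}
      = {i \<in> {1..length \<pi>}. set (take i \<pi>) \<subseteq> {..i}}" by auto
  then show ?thesis unfolding ncomp_def by simp
qed

text \<open>The letters of a proper prefix that is bounded by its length are the smallest ones, and the
permutation splits behind it.\<close>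

lemma indecomposable_prefix:
  assumes "perm \<alpha>" "\<not> splits (<) \<alpha>" "0 < i" "i < length \<alpha>"
  shows "\<not> set (take i \<alpha>) \<subseteq> {..i}"
proof
  assume sub: "set (take i \<alpha>) \<subseteq> {..i}"
  have dist: "distinct (take i \<alpha> @ drop i \<alpha>)" using assms(1) by (simp add: perm_def)
  have "set (take i \<alpha>) \<subseteq> {1..i}"
    using sub perm_pos[OF assms(1)] set_take_subset[of i \<alpha>] by fastforce
  moreover have "card (set (take i \<alpha>)) = i"
    using dist assms(4) by (simp add: distinct_card)
  ultimately have eq: "set (take i \<alpha>) = {1..i}" by (simp add: card_subset_eq)
  have "splits (<) (take i \<alpha> @ drop i \<alpha>)"
  proof (rule splitsI)
    fix u v assume "u \<in> set (take i \<alpha>)" "v \<in> set (drop i \<alpha>)"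
    moreover from this have "v \<notin> set (take i \<alpha>)" "0 < v"
      using set_take_disj_set_drop_if_distinct[of \<alpha> i i] assms(1) perm_pos[OF assms(1)]
        set_drop_subset[of i \<alpha>] unfolding perm_def by blast+
    ultimately show "u < v" unfolding eq by auto
  qed (use assms in auto)
  then show False using assms(2) by simp
qed

text \<open>No component can end strictly inside \<open>\<alpha>\<close>, one ends with \<open>\<alpha>\<close>, and behind \<open>\<alpha>\<close> the components are
those of \<open>\<beta>\<close>.\<close>

lemma ncomp_indecomposable_dsum:
  assumes "perm \<alpha>" "\<alpha> \<noteq> []" "\<not> splits (<) \<alpha>" "perm \<beta>"
  shows "ncomp (\<alpha> \<oplus> \<beta>) = Suc (ncomp \<beta>)"
proof -
  let ?k = "length \<alpha>" and ?m = "length \<beta>"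
  let ?B = "{i \<in> {1..?m}. set (take i \<beta>) \<subseteq> {..i}}"
  have small: "set (take i (\<alpha> \<oplus> \<beta>)) \<subseteq> {..i} \<longleftrightarrow> i = ?k" if "0 < i" "i \<le> ?k" for i
  proof (cases "i = ?k")
    case True
    then show ?thesis using assms(1) by (auto simp: dsum_def perm_def)
  next
    case False
    then show ?thesis using indecomposable_prefix[OF assms(1,3)] that by (simp add: dsum_def)
  qed
  have large: "set (take (?k + i) (\<alpha> \<oplus> \<beta>)) \<subseteq> {..?k + i} \<longleftrightarrow> set (take i \<beta>) \<subseteq> {..i}" for i
    using perm_pos[OF assms(1)] by (fastforce simp: dsum_def take_map)
  have "{i \<in> {1..length (\<alpha> \<oplus> \<beta>)}. set (take i (\<alpha> \<oplus> \<beta>)) \<subseteq> {..i}} = insert ?k ((+) ?k ` ?B)"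
    (is "?L = ?R")
  proof (intro equalityI subsetI)
    fix i assume i: "i \<in> ?L"
    show "i \<in> ?R"
    proof (cases "i \<le> ?k")
      case True
      then show ?thesis using small[of i] i by auto
    next
      case False
      then have "i = ?k + (i - ?k)" "i - ?k \<in> ?B" using i large[of "i - ?k"] by auto
      then show ?thesis by blast
    qed
  next
    fix i assume "i \<in> ?R"
    then consider "i = ?k" | j where "i = ?k + j" "j \<in> ?B" by blast
    then show "i \<in> ?L"
    proof cases
      case 1
      then show ?thesis using small[of ?k] assms(2) by (auto simp: Suc_le_eq)
    next
      case 2
      then show ?thesis using large[of j] by auto
    qed
  qed
  moreover have "?k \<notin> (+) ?k ` ?B" by auto
  ultimately show ?thesis
    unfolding ncomp_eq_card_prefixes by (simp add: card_image)
qed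

text \<open>If the first components had different lengths, the shorter one would be a proper prefix of the
longer one filling an initial segment of the values, against its indecomposability.\<close>

lemma dsum_inj:
  assumes "perm \<alpha>" "perm \<alpha>'" "perm \<beta>" "perm \<beta>'" "\<alpha> \<noteq> []" "\<alpha>' \<noteq> []"
    and "\<not> splits (<) \<alpha>" "\<not> splits (<) \<alpha>'" and eq: "\<alpha> \<oplus> \<beta> = \<alpha>' \<oplus> \<beta>'"
  shows "\<alpha> = \<alpha>' \<and> \<beta> = \<beta>'"
proof -
  have *: False
    if "perm \<alpha>" "perm \<alpha>'" "\<alpha> \<noteq> []" "\<not> splits (<) \<alpha>'" "\<alpha> \<oplus> \<beta> = \<alpha>' \<oplus> \<beta>'" "length \<alpha> < length \<alpha>'"
    for \<alpha> \<alpha>' \<beta> \<beta>'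
  proof -
    have "take (length \<alpha>) (\<alpha> \<oplus> \<beta>) = take (length \<alpha>) (\<alpha>' \<oplus> \<beta>')" using that(5) by simp
    then have "take (length \<alpha>) \<alpha>' = \<alpha>" using that(6) by (simp add: dsum_def)
    then have "set (take (length \<alpha>) \<alpha>') \<subseteq> {..length \<alpha>}"
      using that(1) by (auto simp: perm_def)
    then show False using indecomposable_prefix[OF that(2,4), of "length \<alpha>"] that(3,6) by simp
  qed
  have "length \<alpha> = length \<alpha>'"
    using *[OF assms(1,2,5,8) eq] *[OF assms(2,1,6,7) eq[symmetric]] by (metis linorder_neqE_nat)
  then show ?thesis using eq by (simp add: dsum_def inj_map_eq_map)
qed

section \<open>Generating functions of sets of words\<close>

definition wgf :: "nat list set \<Rightarrow> (nat list \<Rightarrow> 'a) \<Rightarrow> 'a::comm_ring_1 fps" where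
  "wgf A w = Abs_fps (\<lambda>n. \<Sum>\<pi>\<in>{\<pi> \<in> A. length \<pi> = n}. w \<pi>)"

text \<open>An infinite sum is 0 by convention, so \<open>wgf A w\<close> is meaningful for such sets only.\<close>

definition finite_lengthwise :: "nat list set \<Rightarrow> bool" where
  "finite_lengthwise A \<longleftrightarrow> (\<forall>n. finite {\<pi> \<in> A. length \<pi> = n})"

lemma finite_lengthwise_subset:
  assumes "finite_lengthwise B" "A \<subseteq> B"
  shows "finite_lengthwise A"
  unfolding finite_lengthwise_def
proof
  fix n
  have "{\<pi> \<in> A. length \<pi> = n} \<subseteq> {\<pi> \<in> B. length \<pi> = n}" using assms(2) by blast
  then show "finite {\<pi> \<in> A. length \<pi> = n}"
    by (rule finite_subset) (use assms(1) in \<open>simp add: finite_lengthwise_def\<close>)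
qed

lemma finite_lengthwise_perms:
  assumes "A \<subseteq> {\<pi>. perm \<pi>}"
  shows "finite_lengthwise A"
  unfolding finite_lengthwise_def
proof
  fix n
  have "{\<pi> \<in> A. length \<pi> = n} \<subseteq> {\<pi>. perm \<pi> \<and> length \<pi> = n}" using assms by blast
  then show "finite {\<pi> \<in> A. length \<pi> = n}" by (rule finite_subset) (rule finite_perms)
qed

lemma wgf_Un:
  assumes "finite_lengthwise A" "finite_lengthwise B" "A \<inter> B = {}"
  shows "wgf (A \<union> B) w = wgf A w + wgf B w"
proof (rule fps_ext)
  fix n
  have "{\<pi> \<in> A \<union> B. length \<pi> = n} = {\<pi> \<in> A. length \<pi> = n} \<union> {\<pi> \<in> B. length \<pi> = n}" by blast
  then show "wgf (A \<union> B) w $ n = (wgf A w + wgf B w) $ n"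
    using assms unfolding wgf_def finite_lengthwise_def
    by (simp add: sum.union_disjoint[symmetric] disjoint_iff)
qed

lemma wgf_scale: "wgf A (\<lambda>\<pi>. c * w \<pi>) = fps_const c * wgf A w"
  unfolding wgf_def by (rule fps_ext) (simp add: sum_distrib_left)

lemma wgf_Nil: "wgf {[]} w = fps_const (w [])"
proof (rule fps_ext)
  fix n
  have eq: "{\<pi> \<in> {[]}. length \<pi> = n} = (if n = 0 then {[]} else {})" by auto
  show "wgf {[]} w $ n = fps_const (w []) $ n"
    unfolding wgf_def fps_nth_Abs_fps eq by simp
qed

lemma wgf_single: "wgf {[x]} w = fps_const (w [x]) * fps_X"
proof (rule fps_ext)
  fix n
  have eq: "{\<pi> \<in> {[x]}. length \<pi> = n} = (if n = 1 then {[x]} else {})" by auto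
  show "wgf {[x]} w $ n = (fps_const (w [x]) * fps_X) $ n"
    unfolding wgf_def fps_nth_Abs_fps eq by simp
qed

text \<open>A bijection \<open>h\<close> from pairs that adds lengths and multiplies weights turns the product set into the
Cauchy product of the generating functions.\<close>

lemma wgf_product:
  assumes inj: "inj_on (\<lambda>(a, b). h a b) (A \<times> B)"
    and fin: "finite_lengthwise A" "finite_lengthwise B"
    and len: "\<And>a b. a \<in> A \<Longrightarrow> b \<in> B \<Longrightarrow> length (h a b) = length a + length b"
    and wt: "\<And>a b. a \<in> A \<Longrightarrow> b \<in> B \<Longrightarrow> w (h a b) = u a * v b"
  shows "wgf ((\<lambda>(a, b). h a b) ` (A \<times> B)) w = wgf A u * wgf B v"
proof (rule fps_ext)
  fix n
  let ?h = "\<lambda>(a, b). h a b"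
  define S where "S i = {a \<in> A. length a = i} \<times> {b \<in> B. length b = n - i}" for i
  have finS: "finite (S i)" for i using fin by (simp add: S_def finite_lengthwise_def)
  have US: "(\<Union>i\<in>{0..n}. S i) \<subseteq> A \<times> B" by (auto simp: S_def)
  have "{\<pi> \<in> ?h ` (A \<times> B). length \<pi> = n} = ?h ` (\<Union>i\<in>{0..n}. S i)"
  proof (intro equalityI subsetI)
    fix \<pi> assume "\<pi> \<in> {\<pi> \<in> ?h ` (A \<times> B). length \<pi> = n}"
    then obtain a b where ab: "a \<in> A" "b \<in> B" "\<pi> = h a b" "length \<pi> = n" by auto
    then have "(a, b) \<in> S (length a)" "length a \<in> {0..n}" using len[of a b] by (simp_all add: S_def)
    then show "\<pi> \<in> ?h ` (\<Union>i\<in>{0..n}. S i)" using ab(3) by (intro image_eqI[of _ _ "(a, b)"]) auto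
  next
    fix \<pi> assume "\<pi> \<in> ?h ` (\<Union>i\<in>{0..n}. S i)"
    then obtain i a b where ab: "i \<le> n" "(a, b) \<in> S i" "\<pi> = h a b" by auto
    then have "a \<in> A" "b \<in> B" "length \<pi> = n" using len[of a b] by (simp_all add: S_def)
    then show "\<pi> \<in> {\<pi> \<in> ?h ` (A \<times> B). length \<pi> = n}" using ab(3) by auto
  qed
  then have "wgf (?h ` (A \<times> B)) w $ n = sum w (?h ` (\<Union>i\<in>{0..n}. S i))" by (simp add: wgf_def)
  also have "\<dots> = sum (w \<circ> ?h) (\<Union>i\<in>{0..n}. S i)"
    by (rule sum.reindex) (rule inj_on_subset[OF inj US])
  also have "\<dots> = (\<Sum>i\<in>{0..n}. sum (w \<circ> ?h) (S i))"
    using finS by (intro sum.UNION_disjoint) (auto simp: S_def)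
  also have "\<dots> = (\<Sum>i\<in>{0..n}. (\<Sum>a\<in>{a \<in> A. length a = i}. u a) *
      (\<Sum>b\<in>{b \<in> B. length b = n - i}. v b))"
  proof (rule sum.cong[OF refl])
    fix i
    have "sum (w \<circ> ?h) (S i) = (\<Sum>(a, b)\<in>S i. u a * v b)"
      by (rule sum.cong) (auto simp: S_def wt)
    then show "sum (w \<circ> ?h) (S i)
        = (\<Sum>a\<in>{a \<in> A. length a = i}. u a) * (\<Sum>b\<in>{b \<in> B. length b = n - i}. v b)"
      by (simp add: S_def sum_product sum.cartesian_product)
  qed
  also have "\<dots> = (wgf A u * wgf B v) $ n" by (simp add: fps_mult_nth wgf_def)
  finally show "wgf (?h ` (A \<times> B)) w $ n = (wgf A u * wgf B v) $ n" .
qed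

section \<open>Classes of permutations closed under direct sums\<close>

definition wt :: "'a \<Rightarrow> 'a \<Rightarrow> 'a \<Rightarrow> nat list \<Rightarrow> 'a::comm_ring_1" where
  "wt t r p \<pi> = t ^ des \<pi> * r ^ iar \<pi> * p ^ ncomp \<pi>"

lemma wt_Nil [simp]: "wt t r p [] = 1"
  by (simp add: wt_def ncomp_def)

lemma wt_1_1 [simp]: "wt t 1 1 \<pi> = t ^ des \<pi>"
  by (simp add: wt_def)

locale sum_closed_class =
  fixes av :: "nat list \<Rightarrow> bool"
  assumes av_one: "av [1]"
    and av_dsum: "perm \<alpha> \<Longrightarrow> perm \<beta> \<Longrightarrow> av (\<alpha> \<oplus> \<beta>) \<longleftrightarrow> av \<alpha> \<and> av \<beta>"
begin

definition members :: "nat list set" where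
  "members = {\<pi>. perm \<pi> \<and> av \<pi>}"

definition nonempty :: "nat list set" where
  "nonempty = members - {[]}"

definition indecomposables :: "nat list set" where
  "indecomposables = {\<pi> \<in> nonempty. \<not> splits (<) \<pi>}"

text \<open>The one-letter permutation is set apart because it is the only component that an initial
ascending run can pass through completely.\<close>

definition proper_indecomposables :: "nat list set" where
  "proper_indecomposables = indecomposables - {[1]}"

lemma av_Nil [simp]: "av []"
  using av_one av_dsum[of "[1]" "[]"] by simp

lemma Nil_members [simp]: "[] \<in> members"
  by (simp add: members_def)

lemma membersD: "\<pi> \<in> members \<Longrightarrow> perm \<pi>" "\<pi> \<in> members \<Longrightarrow> av \<pi>"
  by (simp_all add: members_def)

lemma nonemptyD: "\<pi> \<in> nonempty \<Longrightarrow> perm \<pi> \<and> av \<pi> \<and> \<pi> \<noteq> []"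
  by (simp add: nonempty_def members_def)

lemma indecomposables_iff:
  "\<pi> \<in> indecomposables \<longleftrightarrow> perm \<pi> \<and> av \<pi> \<and> \<pi> \<noteq> [] \<and> \<not> splits (<) \<pi>"
  by (auto simp: indecomposables_def nonempty_def members_def)

lemma proper_indecomposables_iff:
  "\<pi> \<in> proper_indecomposables \<longleftrightarrow> perm \<pi> \<and> av \<pi> \<and> 2 \<le> length \<pi> \<and> \<not> splits (<) \<pi>"
proof -
  have "\<pi> \<noteq> [] \<and> \<pi> \<noteq> [1] \<longleftrightarrow> 2 \<le> length \<pi>" if "perm \<pi>"
    using that by (cases \<pi>; cases "tl \<pi>") simp_all
  then show ?thesis
    unfolding proper_indecomposables_def by (simp add: indecomposables_iff) blast
qed

lemma indecomposables_eq: "indecomposables = {[1]} \<union> proper_indecomposables"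
proof -
  have "[1] \<in> indecomposables" using av_one by (simp add: indecomposables_iff)
  then show ?thesis unfolding proper_indecomposables_def by blast
qed

lemma finite_lengthwise_classes [simp]:
  "finite_lengthwise members" "finite_lengthwise nonempty"
  "finite_lengthwise indecomposables" "finite_lengthwise proper_indecomposables"
proof -
  show gr: "finite_lengthwise members" by (rule finite_lengthwise_perms) (auto simp: members_def)
  show "finite_lengthwise nonempty" "finite_lengthwise indecomposables"
    "finite_lengthwise proper_indecomposables"
    by (rule finite_lengthwise_subset[OF gr],
        force simp: nonempty_def indecomposables_def proper_indecomposables_def)+
qed

lemma wgf_members: "wgf members w = fps_const (w []) + wgf nonempty w"
proof -
  have "members = {[]} \<union> nonempty" by (auto simp: nonempty_def)
  moreover have "finite_lengthwise {[]}" by (rule finite_lengthwise_perms) simp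
  ultimately show ?thesis
    using wgf_Un[of "{[]}" nonempty w] finite_lengthwise_classes(2) by (simp add: wgf_Nil nonempty_def)
qed

lemma dsum_image_indecomposables:
  "(\<lambda>(\<alpha>, \<beta>). \<alpha> \<oplus> \<beta>) ` (indecomposables \<times> members) = nonempty"
proof (intro equalityI subsetI)
  fix \<pi> assume "\<pi> \<in> (\<lambda>(\<alpha>, \<beta>). \<alpha> \<oplus> \<beta>) ` (indecomposables \<times> members)"
  then obtain \<alpha> \<beta> where "\<pi> = \<alpha> \<oplus> \<beta>" "\<alpha> \<in> indecomposables" "\<beta> \<in> members"
    by (auto simp only: image_iff mem_Times_iff split: prod.splits)
  then show "\<pi> \<in> nonempty"
    by (simp add: indecomposables_iff nonempty_def members_def perm_dsum av_dsum) (simp add: dsum_def)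
next
  fix \<pi> assume \<pi>: "\<pi> \<in> nonempty"
  show "\<pi> \<in> (\<lambda>(\<alpha>, \<beta>). \<alpha> \<oplus> \<beta>) ` (indecomposables \<times> members)"
  proof (cases "splits (<) \<pi>")
    case True
    then obtain us vs where us: "\<pi> = us @ vs" "us \<noteq> []" "vs \<noteq> []"
      "\<And>u v. u \<in> set us \<Longrightarrow> v \<in> set vs \<Longrightarrow> u < v" "\<not> splits (<) us"
      by (rule splits_first) blast
    obtain \<beta> where \<beta>: "perm us" "perm \<beta>" "us @ vs = us \<oplus> \<beta>"
      using perm_split_less[of us vs] us(1,4) nonemptyD[OF \<pi>] by blast
    have "us \<in> indecomposables" "\<beta> \<in> members"
      using us(1,2,5) \<beta> nonemptyD[OF \<pi>] av_dsum[OF \<beta>(1,2)]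
      by (simp_all add: indecomposables_iff members_def)
    then show ?thesis using us(1) \<beta>(3) by (intro image_eqI[of _ _ "(us, \<beta>)"]) simp_all
  next
    case False
    then have "\<pi> \<in> indecomposables" using \<pi> by (simp add: indecomposables_def)
    then show ?thesis by (intro image_eqI[of _ _ "(\<pi>, [])"]) simp_all
  qed
qed

lemma dsum_inj_on: "inj_on (\<lambda>(\<alpha>, \<beta>). \<alpha> \<oplus> \<beta>) (indecomposables \<times> members)"
proof (rule inj_onI, clarify)
  fix \<alpha> \<beta> \<alpha>' \<beta>'
  assume "\<alpha> \<in> indecomposables" "\<alpha>' \<in> indecomposables" "\<beta> \<in> members" "\<beta>' \<in> members"
    and eq: "\<alpha> \<oplus> \<beta> = \<alpha>' \<oplus> \<beta>'"
  then show "\<alpha> = \<alpha>' \<and> \<beta> = \<beta>'"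
    by (intro dsum_inj[OF _ _ _ _ _ _ _ _ eq]) (auto simp: indecomposables_iff membersD)
qed

lemma wgf_nonempty_by_first_component:
  assumes one: "\<And>\<beta>. \<beta> \<in> members \<Longrightarrow> w ([1] \<oplus> \<beta>) = c * u \<beta>"
    and proper: "\<And>\<alpha> \<beta>. \<alpha> \<in> proper_indecomposables \<Longrightarrow> \<beta> \<in> members \<Longrightarrow> w (\<alpha> \<oplus> \<beta>) = v \<alpha> * u' \<beta>"
  shows "wgf nonempty w =
    fps_const c * fps_X * wgf members u + wgf proper_indecomposables v * wgf members u'"
proof -
  let ?h = "\<lambda>(\<alpha>, \<beta>). \<alpha> \<oplus> \<beta>" and ?P = "proper_indecomposables"
  have sub: "{[1]} \<times> members \<subseteq> indecomposables \<times> members"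
    "?P \<times> members \<subseteq> indecomposables \<times> members" unfolding indecomposables_eq by blast+
  have dec: "nonempty = ?h ` ({[1]} \<times> members) \<union> ?h ` (?P \<times> members)"
    unfolding dsum_image_indecomposables[symmetric] indecomposables_eq Sigma_Un_distrib1 image_Un ..
  have "({[1]} \<times> members) \<inter> (?P \<times> members) = {}" by (auto simp: proper_indecomposables_def)
  then have disj: "?h ` ({[1]} \<times> members) \<inter> ?h ` (?P \<times> members) = {}"
    by (simp only: inj_on_image_Int[OF dsum_inj_on sub, symmetric] image_empty)
  have gr: "finite_lengthwise (?h ` ({[1]} \<times> members))" "finite_lengthwise (?h ` (?P \<times> members))"
    by (rule finite_lengthwise_subset[of nonempty], simp, simp only: dec, blast)+
  have g1: "finite_lengthwise {[1]}" by (rule finite_lengthwise_perms) simp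
  have "wgf (?h ` ({[1]} \<times> members)) w = wgf {[1]} (\<lambda>_. c) * wgf members u"
    by (rule wgf_product[OF inj_on_subset[OF dsum_inj_on sub(1)] g1])
       (simp_all only: finite_lengthwise_classes length_dsum singleton_iff one)
  moreover have "wgf (?h ` (?P \<times> members)) w = wgf ?P v * wgf members u'"
    by (rule wgf_product[OF inj_on_subset[OF dsum_inj_on sub(2)]]) (simp_all add: proper)
  ultimately show ?thesis
    using wgf_Un[OF gr disj, of w] unfolding dec[symmetric] by (simp add: wgf_single)
qed

text \<open>A first component \<open>[1]\<close> lengthens the initial ascending run of the rest by one; any other first
component contains the whole run, and then the rest carries no weight \<open>r\<close>.\<close>

lemma wgf_nonempty_wt:
  "wgf nonempty (wt t r p) = fps_const (r * p) * fps_X * wgf members (wt t r p) +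
     fps_const p * wgf proper_indecomposables (wt t r 1) * wgf members (wt t 1 p)"
proof -
  have "wgf nonempty (wt t r p) = fps_const (r * p) * fps_X * wgf members (wt t r p) +
     wgf proper_indecomposables (\<lambda>\<alpha>. p * wt t r 1 \<alpha>) * wgf members (wt t 1 p)"
  proof (rule wgf_nonempty_by_first_component)
    fix \<beta> assume "\<beta> \<in> members"
    then have \<beta>: "perm \<beta>" by (rule membersD)
    have "ncomp ([1] \<oplus> \<beta>) = Suc (ncomp \<beta>)" using \<beta> by (intro ncomp_indecomposable_dsum) simp_all
    then show "wt t r p ([1] \<oplus> \<beta>) = r * p * wt t r p \<beta>"
      using des_dsum[of "[1]" \<beta>] iar_one_dsum[OF \<beta>] \<beta> by (simp add: wt_def mult_ac)
  next
    fix \<alpha> \<beta> assume \<alpha>: "\<alpha> \<in> proper_indecomposables" and "\<beta> \<in> members"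
    then have \<beta>: "perm \<beta>" using membersD by blast
    have a: "perm \<alpha>" "2 \<le> length \<alpha>" "\<not> splits (<) \<alpha>" "\<alpha> \<noteq> []"
      using \<alpha> unfolding proper_indecomposables_iff by auto
    show "wt t r p (\<alpha> \<oplus> \<beta>) = p * wt t r 1 \<alpha> * wt t 1 p \<beta>"
      by (simp add: wt_def power_add mult_ac ncomp_indecomposable_dsum[OF a(1,4,3) \<beta>]
          iar_dsum_indecomposable[OF a(1-3)] des_dsum[OF a(1) \<beta>])
  qed
  then show ?thesis by (simp add: wgf_scale)
qed

end

section \<open>Solving the system of equations\<close>

text \<open>The letters stand for series: \<open>s = F(1, 1)\<close>, \<open>f1 = F(r, 1)\<close>, \<open>g = F(1, p)\<close>, \<open>f = F(r, p)\<close>,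
\<open>b1 = B(1)\<close> and \<open>b = B(r)\<close>. Multiplication by \<open>1 + t s\<close> eliminates \<open>u\<close>.\<close>

lemma schroeder_system_solution:
  fixes z t r p s f f1 b b1 u g :: "'a::field"
  assumes nz: "z \<noteq> 0" "r \<noteq> 0" "p \<noteq> 0" "1 + t * s \<noteq> 0" "1 + (1 - p) * s \<noteq> 0"
      "1 + (1 - r) * s \<noteq> 0" "1 - r * p * z \<noteq> 0"
    and s: "s = z * (1 + s) + b1 * (1 + s)"
    and f1: "f1 = r * z * (1 + f1) + b * (1 + s)"
    and g: "g = p * z * (1 + g) + p * b1 * (1 + g)"
    and f: "f = r * p * z * (1 + f) + p * b * (1 + g)"
    and b1: "b1 = t * s * u" and b: "b = t * f1 * u" and u: "u * (1 + t * s) = s"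
  shows "f / (r * p * z) =
      ((1 / z + 1 - r - p) * s + (1 - r) * (1 - p) * s ^ 2) /
      ((1 - r * p * z) * (1 + (1 - p) * s) * (1 + (1 - r) * s))"
    and "s = z + (1 + t) * z * s + t * z * s ^ 2 + t * s ^ 3"
proof -
  have "s * (1 + t * s) = z * (1 + s) * (1 + t * s) + t * s * s * (1 + s)"
    using s b1 u by algebra
  then show cubic: "s = z + (1 + t) * z * s + t * z * s ^ 2 + t * s ^ 3" by algebra
  \<comment> \<open>The cubic equation in the form \<open>s (1 - t s^2) = z (1 + s) (1 + t s)\<close> makes the factor
    \<open>z (1 + t s)\<close> common to both sides.\<close>
  have "f1 * (1 + t * s) = r * z * (1 + f1) * (1 + t * s) + t * f1 * s * (1 + s)"
    using f1 b u by algebra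
  then have "z * (1 + t * s) * (f1 * (1 + s)) = z * (1 + t * s) * (r * s * (1 + f1))"
    using cubic by algebra
  then have "f1 * (1 + s) = r * s * (1 + f1)" using nz by simp
  then have F1: "f1 * (1 + (1 - r) * s) = r * s" by algebra
  have G: "(1 + g) * (1 + (1 - p) * s) = 1 + s" using g s by algebra
  have "f * (1 - r * p * z) * (1 + (1 - p) * s) = r * p * z * (1 + (1 - p) * s) + p * (b * (1 + s))"
    using f G by algebra
  moreover have "b * (1 + s) = f1 * (1 - r * z) - r * z" using f1 by algebra
  ultimately have "f * ((1 - r * p * z) * (1 + (1 - p) * s) * (1 + (1 - r) * s)) =
      r * p * (z * (1 + (1 - p) * s) * (1 + (1 - r) * s) + s * (1 - r * z) - z * (1 + (1 - r) * s))"
    using F1 by algebra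
  also have "\<dots> = r * p * z * ((1 / z + 1 - r - p) * s + (1 - r) * (1 - p) * s ^ 2)"
    using nz(1) by (simp add: field_simps power2_eq_square)
  finally show "f / (r * p * z) =
      ((1 / z + 1 - r - p) * s + (1 - r) * (1 - p) * s ^ 2) /
      ((1 - r * p * z) * (1 + (1 - p) * s) * (1 + (1 - r) * s))"
    using nz by (simp add: frac_eq_eq mult_ac)
qed

lemma wgf_nth_0_if_nonempty:
  assumes "\<And>\<pi>. \<pi> \<in> A \<Longrightarrow> \<pi> \<noteq> []"
  shows "wgf A w $ 0 = 0"
proof -
  have "{\<pi> \<in> A. length \<pi> = 0} = {}" using assms by auto
  then show ?thesis unfolding wgf_def fps_nth_Abs_fps by (simp only: sum.empty)
qed

lemma fps_nonzero_if_nth_0: "(F :: 'a::comm_ring_1 fps) $ 0 = 1 \<Longrightarrow> F \<noteq> 0"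
  by auto

context sum_closed_class
begin

text \<open>This reduces the main result to a factorization \<open>B(r) = t F(r, 1) U\<close>. The denominators do not vanish,
since as power series they have constant term 1.\<close>

lemma generating_function:
  fixes t r p :: "'a::field" and U :: "'a fps"
  defines "S \<equiv> wgf nonempty (wt t 1 1)"
  assumes "r \<noteq> 0" "p \<noteq> 0"
    and members: "\<And>n. avoiders n P = {\<pi> \<in> members. length \<pi> = n}"
    and factor: "\<And>r. wgf proper_indecomposables (wt t r 1) =
      fps_const t * wgf nonempty (wt t r 1) * U"
    and U: "U * (1 + fps_const t * S) = S"
  shows "gf_avoiders_tilde P t r p =
           ((1 / fls_X + 1 - fls_const r - fls_const p) * fps_to_fls S +
              (1 - fls_const r) * (1 - fls_const p) * fps_to_fls S ^ 2) /
           ((1 - fls_const r * fls_const p * fls_X) * (1 + (1 - fls_const p) * fps_to_fls S) *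
              (1 + (1 - fls_const r) * fps_to_fls S))"
    and "fps_to_fls S = fls_X + (1 + fls_const t) * fls_X * fps_to_fls S +
           fls_const t * fls_X * fps_to_fls S ^ 2 + fls_const t * fps_to_fls S ^ 3"
    and "fps_to_fls (gf_avoiders P t 1 1) - 1 = fps_to_fls S"
proof -
  let ?F = "\<lambda>r p. wgf nonempty (wt t r p)" and ?B = "\<lambda>r. wgf proper_indecomposables (wt t r 1)"
  have gf: "gf_avoiders P t r p = 1 + ?F r p" for r p
  proof -
    have "gf_avoiders P t r p = wgf members (wt t r p)"
      by (simp add: gf_avoiders_def wgf_def members wt_def)
    then show ?thesis by (simp add: wgf_members)
  qed
  show "fps_to_fls (gf_avoiders P t 1 1) - 1 = fps_to_fls S"
    by (simp add: gf S_def)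
  have F: "?F r p = fps_const r * fps_const p * fps_X * (1 + ?F r p) + fps_const p * ?B r * (1 + ?F 1 p)"
    for r p using wgf_nonempty_wt[of t r p] by (simp add: wgf_members)
  have F0: "?F r p $ 0 = 0" for r p by (rule wgf_nth_0_if_nonempty) (simp add: nonempty_def)
  let ?h = "fps_to_fls :: 'a fps \<Rightarrow> 'a fls"
  note hom = fls_times_fps_to_fls
  have nz: "1 + fls_const c * ?h S \<noteq> 0" for c
  proof -
    have "1 + fps_const c * S \<noteq> 0" by (rule fps_nonzero_if_nth_0) (simp add: S_def F0)
    then have "?h (1 + fps_const c * S) \<noteq> 0" by (simp only: fps_to_fls_eq_0_iff not_False_eq_True)
    then show ?thesis by (simp add: hom)
  qed
  have nz1: "1 - fls_const r * fls_const p * fls_X \<noteq> (0 :: 'a fls)"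
  proof -
    have "1 - fps_const r * fps_const p * fps_X \<noteq> (0 :: 'a fps)" by (rule fps_nonzero_if_nth_0) simp
    then have "?h (1 - fps_const r * fps_const p * fps_X) \<noteq> 0"
      by (simp only: fps_to_fls_eq_0_iff not_False_eq_True)
    then show ?thesis by (simp add: hom)
  qed
  have sys: "?h (?F r p) = fls_const r * fls_const p * fls_X * (1 + ?h (?F r p)) +
      fls_const p * ?h (?B r) * (1 + ?h (?F 1 p))" for r p
    using arg_cong[OF F[of r p], of ?h] by (simp add: hom)
  have fac: "?h (?B r) = fls_const t * ?h (?F r 1) * ?h U" for r
    using arg_cong[OF factor[of r], of ?h] by (simp add: hom)
  have US: "?h U * (1 + fls_const t * ?h S) = ?h S"
    using arg_cong[OF U, of ?h] by (simp add: hom)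
  have one_minus: "1 - fls_const c = fls_const (1 - c)" for c :: 'a
    by (simp add: fls_minus_const[symmetric] flip: fls_const_1)
  have rp: "fls_const r \<noteq> 0" "fls_const p \<noteq> 0" using assms(2,3) by simp_all
  have nz2: "1 + (1 - fls_const c) * ?h S \<noteq> 0" for c
    unfolding one_minus by (rule nz)
  have eqs: "?h S = fls_X * (1 + ?h S) + ?h (?B 1) * (1 + ?h S)"
    "?h (?F r 1) = fls_const r * fls_X * (1 + ?h (?F r 1)) + ?h (?B r) * (1 + ?h S)"
    "?h (?F 1 p) = fls_const p * fls_X * (1 + ?h (?F 1 p)) + fls_const p * ?h (?B 1) * (1 + ?h (?F 1 p))"
    using sys[of 1 1] sys[of r 1] sys[of 1 p] by (simp_all add: S_def)
  have b1: "?h (?B 1) = fls_const t * ?h S * ?h U" using fac[of 1] by (simp only: S_def)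
  have "fls_X \<noteq> (0 :: 'a fls)" by simp
  note sol = schroeder_system_solution[OF this rp nz nz2 nz2 nz1 eqs sys b1 fac US]
  show "fps_to_fls S = fls_X + (1 + fls_const t) * fls_X * fps_to_fls S +
           fls_const t * fls_X * fps_to_fls S ^ 2 + fls_const t * fps_to_fls S ^ 3"
    by (rule sol(2))
  have "gf_avoiders_tilde P t r p = ?h (?F r p) / (fls_const r * fls_const p * fls_X)"
    unfolding gf_avoiders_tilde_def by (simp add: gf)
  then show "gf_avoiders_tilde P t r p =
           ((1 / fls_X + 1 - fls_const r - fls_const p) * fps_to_fls S +
              (1 - fls_const r) * (1 - fls_const p) * fps_to_fls S ^ 2) /
           ((1 - fls_const r * fls_const p * fls_X) * (1 + (1 - fls_const p) * fps_to_fls S) *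
              (1 + (1 - fls_const r) * fps_to_fls S))"
    using sol(1) by simp
qed

end

section \<open>Separable permutations\<close>

text \<open>This is the inductive step for decomposing separable permutations, with \<open>R\<close> either \<open>(<)\<close> or \<open>(>)\<close>; let
\<open>R\<close> be \<open>(<)\<close>. Let \<open>us\<close> be the first component of \<open>ys\<close> and \<open>vs\<close> the rest. If the new last letter \<open>c\<close> lies
below all letters or above \<open>us\<close>, then a split of \<open>ys @ [c]\<close> is visible. Otherwise \<open>us\<close> has letters below
and above \<open>c\<close>; as \<open>us\<close> does not split, some letter above \<open>c\<close> precedes some letter below \<open>c\<close>, and with
a letter of \<open>vs\<close> and \<open>c\<close> they form the pattern 3142. For \<open>(>)\<close> it is 2413.\<close>

lemma splits_snoc:
  assumes dist: "distinct (ys @ [c])"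
    and total: "\<And>x y. x \<in> set (ys @ [c]) \<Longrightarrow> y \<in> set (ys @ [c]) \<Longrightarrow> x \<noteq> y \<Longrightarrow> R x y \<or> R y x"
    and trans: "\<And>x y z. R x y \<Longrightarrow> R y z \<Longrightarrow> R x z"
    and "splits R ys"
    and no_pattern: "\<And>a b v. before ys a b \<Longrightarrow> before ys b v \<Longrightarrow> R b c \<Longrightarrow> R c a \<Longrightarrow> R a v \<Longrightarrow> False"
  shows "splits R (ys @ [c]) \<or> splits (\<lambda>x y. R y x) (ys @ [c])"
proof -
  obtain us vs where us: "ys = us @ vs" "us \<noteq> []" "vs \<noteq> []"
    "\<And>u v. u \<in> set us \<Longrightarrow> v \<in> set vs \<Longrightarrow> R u v" "\<not> splits R us"
    using \<open>splits R ys\<close> by (rule splits_first) blast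
  have cmp: "R c x" if "x \<in> set ys" "\<not> R x c" for x
    using total[of x c] that dist by auto
  show ?thesis
  proof (cases "(\<forall>x\<in>set ys. R c x) \<or> (\<forall>u\<in>set us. R u c)")
    case True
    then show ?thesis
    proof
      assume "\<forall>x\<in>set ys. R c x"
      then have "splits (\<lambda>x y. R y x) (ys @ [c])" using us(1,2) by (intro splitsI) auto
      then show ?thesis ..
    next
      assume "\<forall>u\<in>set us. R u c"
      then have "splits R (us @ (vs @ [c]))" using us(2-4) by (intro splitsI) auto
      then show ?thesis using us(1) by simp
    qed
  next
    case False
    then obtain x y where x: "x \<in> set ys" "\<not> R c x" and y: "y \<in> set us" "\<not> R y c" by blast
    have "R c y" using cmp[of y] y us(1) by simp
    then have "x \<notin> set vs" using us(4)[OF y(1), of x] trans x(2) by blast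
    then have "x \<in> set us" using x(1) us(1) by simp
    have "R x c" using total[of x c] x dist by auto
    define ls rs where "ls = takeWhile (\<lambda>u. R u c) us" and "rs = dropWhile (\<lambda>u. R u c) us"
    have us_eq: "us = ls @ rs" by (simp add: ls_def rs_def)
    have ls: "R u c" if "u \<in> set ls" for u using that set_takeWhileD unfolding ls_def by fast
    then have "y \<in> set rs" using y us_eq by auto
    then obtain h rs' where rs: "rs = h # rs'" by (cases rs) auto
    then have "\<not> R h c" unfolding rs_def by (simp add: dropWhile_eq_Cons_conv)
    then have "R c h" using cmp[of h] us(1) us_eq rs by simp
    have "\<exists>v\<in>set rs. R v c"
    proof (rule ccontr)
      assume none: "\<not> (\<exists>v\<in>set rs. R v c)"
      then have "x \<in> set ls" using \<open>x \<in> set us\<close> \<open>R x c\<close> us_eq by auto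
      moreover have "R u v" if "u \<in> set ls" "v \<in> set rs" for u v
        using trans[OF ls[OF that(1)]] cmp[of v] none that(2) us(1) us_eq by auto
      ultimately have "splits R (ls @ rs)" using rs by (intro splitsI) auto
      then show False using us(5) us_eq by simp
    qed
    then obtain v where v: "v \<in> set rs'" "R v c" using rs \<open>\<not> R h c\<close> by auto
    obtain w where w: "w \<in> set vs" using us(3) by (cases vs) auto
    have "before ys h v" "before ys v w"
      using v w by (simp_all add: us(1) us_eq rs before_append)
    moreover have "R h w" using us(4)[OF _ w, of h] us_eq rs by simp
    ultimately show ?thesis using no_pattern v(2) \<open>R c h\<close> by blast
  qed
qed

definition separable :: "nat list \<Rightarrow> bool" where
  "separable \<pi> \<longleftrightarrow> (\<forall>a b c d. before \<pi> a b \<and> before \<pi> b c \<and> before \<pi> c d \<longrightarrow>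
     \<not> (c < a \<and> a < d \<and> d < b) \<and> \<not> (b < d \<and> d < a \<and> a < c))"

lemma separable_splits:
  "distinct \<pi> \<Longrightarrow> separable \<pi> \<Longrightarrow> 2 \<le> length \<pi> \<Longrightarrow> splits (<) \<pi> \<or> splits (>) \<pi>"
proof (induction \<pi> rule: rev_induct)
  case (snoc c ys)
  have sep: "separable ys" using snoc.prems(2) unfolding separable_def before_append by blast
  have no: "\<not> (b < c \<and> c < a \<and> a < v) \<and> \<not> (v < a \<and> a < c \<and> c < b)"
    if "before ys a b" "before ys b v" for a b v
  proof -
    have "before (ys @ [c]) a b" "before (ys @ [c]) b v" "before (ys @ [c]) v c"
      using that before_in_set[OF that(2)] by (auto simp: before_append)
    then show ?thesis using snoc.prems(2) unfolding separable_def by blast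
  qed
  have greater: "(\<lambda>x y. x > y) = (>)" for x :: nat by simp
  show ?case
  proof (cases "2 \<le> length ys")
    case True
    then consider "splits (<) ys" | "splits (>) ys" using snoc sep by auto
    then show ?thesis
    proof cases
      case 1
      show ?thesis
        by (rule splits_snoc[OF snoc.prems(1) _ _ 1]) (use no in auto)
    next
      case 2
      have "splits (>) (ys @ [c]) \<or> splits (\<lambda>x y. y > x) (ys @ [c])"
        by (rule splits_snoc[OF snoc.prems(1) _ _ 2]) (use no in auto)
      then show ?thesis by auto
    qed
  next
    case False
    then obtain y where "ys = [y]" using snoc.prems(3) by (cases ys; cases "tl ys") auto
    then have "y < c \<or> c < y" "ys = [y]" using snoc.prems(1) by auto
    then show ?thesis using splitsI[of "[y]" "[c]" "(<)"] splitsI[of "[y]" "[c]" "(>)"] by auto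
  qed
qed simp

text \<open>An occurrence of 2413 or 3142 with letters in both parts would exhibit the pattern as a direct sum,
which it is not.\<close>

lemma separable_append_less:
  assumes lt: "\<And>u v. u \<in> set us \<Longrightarrow> v \<in> set vs \<Longrightarrow> u < v"
  shows "separable (us @ vs) \<longleftrightarrow> separable us \<and> separable vs"
proof
  assume "separable us \<and> separable vs"
  then have us: "separable us" and vs: "separable vs" by simp_all
  show "separable (us @ vs)" unfolding separable_def
  proof (intro allI impI, elim conjE)
    fix a b c d
    assume *: "before (us @ vs) a b" "before (us @ vs) b c" "before (us @ vs) c d"
    have disj: "x \<in> set us \<Longrightarrow> x \<notin> set vs" for x using lt by blast
    show "\<not> (c < a \<and> a < d \<and> d < b) \<and> \<not> (b < d \<and> d < a \<and> a < c)"
      using * us[unfolded separable_def, rule_format, of a b c d]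
        vs[unfolded separable_def, rule_format, of a b c d]
        disj[of b] disj[of c] lt[of a c] lt[of b d] lt[of a b] lt[of a d]
        before_in_set[of us a b] before_in_set[of us b c] before_in_set[of us c d]
        before_in_set[of vs a b] before_in_set[of vs b c] before_in_set[of vs c d]
      unfolding before_append by (elim disjE) auto
  qed
qed (auto simp: separable_def before_append)

text \<open>Neither 2413 nor 3142 is a skew sum.\<close>

lemma separable_append_greater:
  assumes gt: "\<And>u v. u \<in> set us \<Longrightarrow> v \<in> set vs \<Longrightarrow> u > v"
  shows "separable (us @ vs) \<longleftrightarrow> separable us \<and> separable vs"
proof
  assume "separable us \<and> separable vs"
  then have us: "separable us" and vs: "separable vs" by simp_all
  show "separable (us @ vs)" unfolding separable_def
  proof (intro allI impI, elim conjE)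
    fix a b c d
    assume *: "before (us @ vs) a b" "before (us @ vs) b c" "before (us @ vs) c d"
    have disj: "x \<in> set us \<Longrightarrow> x \<notin> set vs" for x using gt by blast
    show "\<not> (c < a \<and> a < d \<and> d < b) \<and> \<not> (b < d \<and> d < a \<and> a < c)"
      using * us[unfolded separable_def, rule_format, of a b c d]
        vs[unfolded separable_def, rule_format, of a b c d]
        disj[of b] disj[of c] gt[of a c] gt[of b d] gt[of a b] gt[of a d]
        before_in_set[of us a b] before_in_set[of us b c] before_in_set[of us c d]
        before_in_set[of vs a b] before_in_set[of vs b c] before_in_set[of vs c d]
      unfolding before_append by (elim disjE) auto
  qed
qed (auto simp: separable_def before_append)

lemma separable_map:
  assumes mono: "strict_mono_on (set xs) f"
  shows "separable (map f xs) \<longleftrightarrow> separable xs"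
proof
  assume *: "separable (map f xs)"
  show "separable xs" unfolding separable_def
  proof (intro allI impI, elim conjE)
    fix a b c d assume b: "before xs a b" "before xs b c" "before xs c d"
    then have m: "before (map f xs) (f a) (f b)" "before (map f xs) (f b) (f c)"
      "before (map f xs) (f c) (f d)"
      using b before_in_set[OF b(1)] before_in_set[OF b(3)]
      by (simp_all add: before_map_strict_mono[OF mono])
    have "a \<in> set xs" "b \<in> set xs" "c \<in> set xs" "d \<in> set xs"
      using before_in_set[OF b(1)] before_in_set[OF b(3)] by simp_all
    then show "\<not> (c < a \<and> a < d \<and> d < b) \<and> \<not> (b < d \<and> d < a \<and> a < c)"
      using *[unfolded separable_def, rule_format, of "f a" "f b" "f c" "f d"] m
        strict_mono_on_less_iff[OF mono] by simp
  qed
next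
  assume *: "separable xs"
  show "separable (map f xs)" unfolding separable_def
  proof (intro allI impI, elim conjE)
    fix A B C D
    assume b: "before (map f xs) A B" "before (map f xs) B C" "before (map f xs) C D"
    have "A \<in> f ` set xs" "B \<in> f ` set xs" "C \<in> f ` set xs" "D \<in> f ` set xs"
      using b before_in_set[of "map f xs"] by (metis list.set_map)+
    then obtain a b c d where e: "A = f a" "B = f b" "C = f c" "D = f d"
      and in_xs: "a \<in> set xs" "b \<in> set xs" "c \<in> set xs" "d \<in> set xs" by blast
    have "before xs a b" "before xs b c" "before xs c d"
      using b in_xs unfolding e by (simp_all add: before_map_strict_mono[OF mono])
    then show "\<not> (C < A \<and> A < D \<and> D < B) \<and> \<not> (B < D \<and> D < A \<and> A < C)"
      using *[unfolded separable_def, rule_format, of a b c d] in_xs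
        strict_mono_on_less_iff[OF mono] unfolding e by simp
  qed
qed

interpretation separable: sum_closed_class separable
proof
  show "separable [1]" by (simp add: separable_def)
next
  fix \<alpha> \<beta> assume "perm \<alpha>" "perm \<beta>"
  then show "separable (\<alpha> \<oplus> \<beta>) \<longleftrightarrow> separable \<alpha> \<and> separable \<beta>"
    unfolding dsum_def using dsum_less[of \<alpha> \<beta>]
    by (subst separable_append_less) (auto simp: separable_map)
qed

definition skew_sum :: "nat list \<Rightarrow> nat list \<Rightarrow> nat list" (infixr "\<ominus>" 65) where
  "\<alpha> \<ominus> \<beta> = map ((+) (length \<beta>)) \<alpha> @ \<beta>"

lemma length_skew_sum [simp]: "length (\<alpha> \<ominus> \<beta>) = length \<alpha> + length \<beta>"
  by (simp add: skew_sum_def)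

lemma skew_sum_greater:
  assumes "perm \<alpha>" "perm \<beta>" "x \<in> set (map ((+) (length \<beta>)) \<alpha>)" "y \<in> set \<beta>"
  shows "x > y"
  using dsum_less[OF assms(2,1,4,3)] .

lemma perm_skew_sum:
  assumes "perm \<alpha>" "perm \<beta>"
  shows "perm (\<alpha> \<ominus> \<beta>)"
proof (rule permI)
  have "set (\<alpha> \<ominus> \<beta>) = set (\<beta> \<oplus> \<alpha>)" by (auto simp: skew_sum_def dsum_def)
  also have "\<dots> = {1..length (\<alpha> \<ominus> \<beta>)}"
    using perm_dsum[OF assms(2,1)] by (simp add: perm_def add.commute)
  finally show "set (\<alpha> \<ominus> \<beta>) = {1..length (\<alpha> \<ominus> \<beta>)}" .
qed

lemma splits_skew_sum:
  assumes "perm \<alpha>" "perm \<beta>" "\<alpha> \<noteq> []" "\<beta> \<noteq> []"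
  shows "splits (>) (\<alpha> \<ominus> \<beta>)"
  unfolding skew_sum_def using assms skew_sum_greater[OF assms(1,2)] by (intro splitsI) auto

lemma perm_split_greater:
  assumes "perm (us @ vs)" "\<And>u v. u \<in> set us \<Longrightarrow> v \<in> set vs \<Longrightarrow> u > v"
  obtains \<alpha> where "perm \<alpha>" "perm vs" "us @ vs = \<alpha> \<ominus> vs"
proof -
  have dist: "distinct us" "distinct vs" using assms(1) by (auto simp: perm_def)
  have "set vs \<union> set us = {1..length vs + length us}"
    using assms(1) by (simp add: perm_def Un_commute add.commute)
  note seg = initial_segment_eq[OF this]
  have "set vs = {1..length vs}" "set us = {length vs + 1..length vs + length us}"
    using seg assms(2) dist by (simp_all add: distinct_card)
  then show ?thesis
    using that perm_unshift[OF dist(1)] unfolding skew_sum_def by (metis permI)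
qed

lemma skew_sum_descent:
  assumes "perm \<alpha>" "perm \<beta>" "\<alpha> \<noteq> []" "\<beta> \<noteq> []"
  shows "des (\<alpha> \<ominus> \<beta>) = des \<alpha> + 1 + des \<beta>" "iar (\<alpha> \<ominus> \<beta>) = iar \<alpha>"
proof -
  let ?\<alpha> = "map ((+) (length \<beta>)) \<alpha>"
  have "last ?\<alpha> > hd \<beta>"
    using assms by (intro skew_sum_greater[of \<alpha> \<beta>] last_in_set hd_in_set) simp_all
  then have "des (?\<alpha> @ \<beta>) = des ?\<alpha> + 1 + des \<beta>" "iar (?\<alpha> @ \<beta>) = iar ?\<alpha>"
    using assms by (simp_all add: des_append iar_append_descent)
  then show "des (\<alpha> \<ominus> \<beta>) = des \<alpha> + 1 + des \<beta>" "iar (\<alpha> \<ominus> \<beta>) = iar \<alpha>"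
    by (simp_all add: skew_sum_def des_map iar_map)
qed

lemma separable_skew_sum:
  assumes "perm \<alpha>" "perm \<beta>"
  shows "separable (\<alpha> \<ominus> \<beta>) \<longleftrightarrow> separable \<alpha> \<and> separable \<beta>"
  unfolding skew_sum_def
  using skew_sum_greater[OF assms] by (subst separable_append_greater) (auto simp: separable_map)

text \<open>Otherwise the longer one of the two last components would split in front of the shorter one.\<close>

lemma skew_sum_inj:
  assumes "perm \<alpha>" "perm \<alpha>'" "perm \<beta>" "perm \<beta>'" "\<beta> \<noteq> []" "\<beta>' \<noteq> []"
    and "\<not> splits (>) \<beta>" "\<not> splits (>) \<beta>'" and eq: "\<alpha> \<ominus> \<beta> = \<alpha>' \<ominus> \<beta>'"
  shows "\<alpha> = \<alpha>' \<and> \<beta> = \<beta>'"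
proof -
  have *: False
    if "perm \<alpha>" "perm \<beta>" "\<beta> \<noteq> []" "\<not> splits (>) \<beta>'" "\<alpha> \<ominus> \<beta> = \<alpha>' \<ominus> \<beta>'" "length \<beta> < length \<beta>'"
    for \<alpha> \<alpha>' \<beta> \<beta>'
  proof -
    note eq' = that(5) and len = that(6)
    obtain ws where ws: "\<beta>' = ws @ \<beta>" "map ((+) (length \<beta>)) \<alpha> = map ((+) (length \<beta>')) \<alpha>' @ ws"
      using eq' len unfolding skew_sum_def append_eq_append_conv2 by auto
    have "splits (>) (ws @ \<beta>)"
    proof (rule splitsI)
      show "ws \<noteq> []" using ws(1) that(6) by auto
      fix u v assume "u \<in> set ws" "v \<in> set \<beta>"
      moreover from this have "u \<in> set (map ((+) (length \<beta>)) \<alpha>)" unfolding ws(2) by simp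
      ultimately show "u > v" using skew_sum_greater[OF that(1,2)] by blast
    qed (fact that(3))
    then show False using that(4) ws(1) by simp
  qed
  have "length \<beta> = length \<beta>'"
    using *[OF assms(1,3,5,8) eq] *[OF assms(2,4,6,7) eq[symmetric]] by (metis linorder_neqE_nat)
  then show ?thesis using eq by (simp add: skew_sum_def inj_map_eq_map)
qed

definition skew_indecomposables :: "nat list set" where
  "skew_indecomposables = {\<pi> \<in> separable.nonempty. \<not> splits (>) \<pi>}"

lemma skew_sum_image:
  "(\<lambda>(\<alpha>, \<beta>). \<alpha> \<ominus> \<beta>) ` (separable.nonempty \<times> skew_indecomposables) = separable.proper_indecomposables"
proof (intro equalityI subsetI)
  fix \<pi> assume "\<pi> \<in> (\<lambda>(\<alpha>, \<beta>). \<alpha> \<ominus> \<beta>) ` (separable.nonempty \<times> skew_indecomposables)"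
  then obtain \<alpha> \<beta> where \<pi>: "\<pi> = \<alpha> \<ominus> \<beta>" and "\<alpha> \<in> separable.nonempty" "\<beta> \<in> separable.nonempty"
    by (auto simp only: image_iff mem_Times_iff skew_indecomposables_def mem_Collect_eq split: prod.splits)
  then have \<alpha>\<beta>: "perm \<alpha>" "perm \<beta>" "separable \<alpha>" "separable \<beta>" "\<alpha> \<noteq> []" "\<beta> \<noteq> []"
    using separable.nonemptyD by blast+
  then have "\<not> splits (<) \<pi>"
    unfolding \<pi> using splits_skew_sum not_splits_less_and_greater by blast
  moreover have "2 \<le> length \<pi>" using \<alpha>\<beta>(5,6) unfolding \<pi> by (cases \<alpha>; cases \<beta>) simp_all
  ultimately show "\<pi> \<in> separable.proper_indecomposables"
    unfolding separable.proper_indecomposables_iff \<pi>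
    using \<alpha>\<beta> by (simp add: perm_skew_sum separable_skew_sum)
next
  fix \<pi> assume "\<pi> \<in> separable.proper_indecomposables"
  then have \<pi>: "perm \<pi>" "separable \<pi>" "2 \<le> length \<pi>" "\<not> splits (<) \<pi>"
    unfolding separable.proper_indecomposables_iff by simp_all
  then have "splits (>) \<pi>" using separable_splits by (auto simp: perm_def)
  then obtain us vs where us: "\<pi> = us @ vs" "us \<noteq> []" "vs \<noteq> []"
      "\<And>u v. u \<in> set us \<Longrightarrow> v \<in> set vs \<Longrightarrow> u > v" "\<not> splits (>) vs"
    by (rule splits_last) blast
  obtain \<alpha> where \<alpha>: "perm \<alpha>" "perm vs" "us @ vs = \<alpha> \<ominus> vs"
    using perm_split_greater[of us vs] us(1,4) \<pi>(1) by blast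
  have "\<alpha> \<noteq> []" using \<alpha>(3) us(2) by (auto simp: skew_sum_def)
  then have "\<alpha> \<in> separable.nonempty" "vs \<in> skew_indecomposables"
    using us(1,3,5) \<alpha> \<pi>(2) separable_skew_sum[OF \<alpha>(1,2)]
    by (simp_all add: skew_indecomposables_def separable.nonempty_def separable.members_def)
  then show "\<pi> \<in> (\<lambda>(\<alpha>, \<beta>). \<alpha> \<ominus> \<beta>) ` (separable.nonempty \<times> skew_indecomposables)"
    using us(1) \<alpha>(3) by (intro image_eqI[of _ _ "(\<alpha>, vs)"]) simp_all
qed

lemma skew_sum_inj_on:
  "inj_on (\<lambda>(\<alpha>, \<beta>). \<alpha> \<ominus> \<beta>) (separable.nonempty \<times> skew_indecomposables)"
proof (rule inj_onI, clarify)
  fix \<alpha> \<beta> \<alpha>' \<beta>'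
  assume "\<alpha> \<in> separable.nonempty" "\<alpha>' \<in> separable.nonempty"
    "\<beta> \<in> skew_indecomposables" "\<beta>' \<in> skew_indecomposables"
    and eq: "\<alpha> \<ominus> \<beta> = \<alpha>' \<ominus> \<beta>'"
  then show "\<alpha> = \<alpha>' \<and> \<beta> = \<beta>'"
    by (intro skew_sum_inj[OF _ _ _ _ _ _ _ _ eq])
       (auto simp: skew_indecomposables_def dest: separable.nonemptyD)
qed

lemma finite_lengthwise_skew_indecomposables: "finite_lengthwise skew_indecomposables"
  by (rule finite_lengthwise_subset[OF separable.finite_lengthwise_classes(2)])
     (auto simp: skew_indecomposables_def)

lemma separable_factorization:
  "wgf separable.proper_indecomposables (wt t r 1) =
     fps_const t * wgf separable.nonempty (wt t r 1) * wgf skew_indecomposables (wt t 1 1)"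
proof -
  have "wgf separable.proper_indecomposables (wt t r 1) =
      wgf separable.nonempty (\<lambda>\<alpha>. t * wt t r 1 \<alpha>) * wgf skew_indecomposables (wt t 1 1)"
    unfolding skew_sum_image[symmetric]
  proof (rule wgf_product[OF skew_sum_inj_on separable.finite_lengthwise_classes(2)
        finite_lengthwise_skew_indecomposables])
    fix \<alpha> \<beta> assume "\<alpha> \<in> separable.nonempty" "\<beta> \<in> skew_indecomposables"
    then have "perm \<alpha>" "perm \<beta>" "\<alpha> \<noteq> []" "\<beta> \<noteq> []"
      by (auto simp: skew_indecomposables_def dest: separable.nonemptyD)
    then show "wt t r 1 (\<alpha> \<ominus> \<beta>) = t * wt t r 1 \<alpha> * wt t 1 1 \<beta>"
      by (simp add: wt_def skew_sum_descent power_add mult_ac)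
  qed simp
  then show ?thesis by (simp add: wgf_scale)
qed

lemma separable_skew_equation:
  defines "S \<equiv> \<lambda>t :: 'a::comm_ring_1. wgf separable.nonempty (wt t 1 1)"
  shows "wgf skew_indecomposables (wt t 1 1) * (1 + fps_const t * S t) = S t"
proof -
  have "separable.nonempty = skew_indecomposables \<union> separable.proper_indecomposables"
  proof (intro equalityI subsetI)
    fix \<pi> assume \<pi>: "\<pi> \<in> separable.nonempty"
    show "\<pi> \<in> skew_indecomposables \<union> separable.proper_indecomposables"
    proof (cases "splits (>) \<pi>")
      case True
      then have "\<pi> \<noteq> [1]" "\<not> splits (<) \<pi>" using not_splits_less_and_greater by auto
      then show ?thesis
        using \<pi> by (simp add: separable.proper_indecomposables_def separable.indecomposables_def)
    qed (use \<pi> in \<open>simp add: skew_indecomposables_def\<close>)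
  qed (auto simp: skew_indecomposables_def separable.proper_indecomposables_def
      separable.indecomposables_def)
  moreover have "skew_indecomposables \<inter> separable.proper_indecomposables = {}"
    by (auto simp: skew_indecomposables_def separable.proper_indecomposables_iff perm_def
        dest: separable_splits)
  ultimately have "S t = wgf skew_indecomposables (wt t 1 1) +
      wgf separable.proper_indecomposables (wt t 1 1)"
    unfolding S_def by (simp add: wgf_Un finite_lengthwise_skew_indecomposables)
  then show ?thesis
    unfolding separable_factorization[of t 1] S_def by (simp add: algebra_simps)
qed

section \<open>Classes decomposed around the letter 1\<close>

text \<open>A sum split of \<open>us @ m # vs\<close> cannot separate the minimum \<open>m\<close> from letters in front of it, so it lies
behind \<open>m\<close>; of \<open>us\<close> it then depends on the largest letter only.\<close>

lemma splits_around_minimum: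
  fixes us vs :: "'a::linorder list"
  assumes "us \<noteq> []" "\<And>u. u \<in> set us \<Longrightarrow> m < u"
  shows "splits (<) (us @ m # vs) \<longleftrightarrow> splits (<) (Max (set us) # vs)"
proof -
  let ?M = "Max (set us)"
  have M: "?M \<in> set us" "\<And>u. u \<in> set us \<Longrightarrow> u \<le> ?M" using assms(1) by simp_all
  show ?thesis
  proof
    assume "splits (<) (us @ m # vs)"
    then obtain as bs where ab: "us @ m # vs = as @ bs" "as \<noteq> []" "bs \<noteq> []"
      "\<And>a b. a \<in> set as \<Longrightarrow> b \<in> set bs \<Longrightarrow> a < b" unfolding splits_def by blast
    obtain as' where as': "as = us @ m # as'" "vs = as' @ bs"
    proof -
      consider ws where "as = us @ ws" "m # vs = ws @ bs" | ws where "us = as @ ws" "bs = ws @ m # vs"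
        using ab(1) by (auto simp: append_eq_append_conv2)
      then show ?thesis
      proof cases
        case 1
        show ?thesis
        proof (cases ws)
          case Nil
          then have "m \<in> set bs" "hd us \<in> set as" using 1 assms(1) by (auto simp flip: 1(2))
          then show ?thesis using ab(4)[of "hd us" m] assms(2)[of "hd us"] assms(1) by simp
        next
          case (Cons w ws')
          then show ?thesis using that[of ws'] 1 by simp
        qed
      next
        case 2
        then have "m \<in> set bs" "hd as \<in> set as" "hd as \<in> set us" using ab(2) by auto
        then show ?thesis using ab(4)[of "hd as" m] assms(2)[of "hd as"] by simp
      qed
    qed
    have "splits (<) ((?M # as') @ bs)" using ab(3,4) as' M(1) by (intro splitsI) auto
    then show "splits (<) (?M # vs)" using as' by simp
  next
    assume "splits (<) (?M # vs)"
    then obtain as bs where ab: "?M # vs = as @ bs" "as \<noteq> []" "bs \<noteq> []"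
      "\<And>a b. a \<in> set as \<Longrightarrow> b \<in> set bs \<Longrightarrow> a < b" unfolding splits_def by blast
    then obtain as' where as': "as = ?M # as'" "vs = as' @ bs" by (cases as) auto
    have small: "x < b" if "x \<in> insert m (set us)" "b \<in> set bs" for x b
    proof -
      have "?M < b" using ab(4) as'(1) that(2) by simp
      moreover have "x \<le> ?M" using that(1) M assms(2)[OF M(1)] by auto
      ultimately show ?thesis by simp
    qed
    have "splits (<) ((us @ m # as') @ bs)"
    proof (rule splitsI)
      fix x b assume "x \<in> set (us @ m # as')" "b \<in> set bs"
      then show "x < b" using small[of x b] ab(4)[of x b] as'(1) by auto
    qed (use ab(3) in auto)
    then show "splits (<) (us @ m # vs)" using as' by simp
  qed
qed

lemma perm_if_distinct_subset:
  assumes "distinct \<pi>" "set \<pi> \<subseteq> {1..length \<pi>}"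
  shows "perm \<pi>"
  unfolding perm_def using assms by (simp add: card_subset_eq distinct_card)

lemma map_preimage:
  assumes "set vs \<subseteq> h ` A"
  obtains ws where "set ws \<subseteq> A" "vs = map h ws"
proof
  show "set (map (inv_into A h) vs) \<subseteq> A" using assms by (auto intro: inv_into_into)
  show "vs = map h (map (inv_into A h) vs)" using assms f_inv_into_f[of _ h A]
    by (auto intro!: map_idI[symmetric])
qed

text \<open>In a glued permutation the first letter of the second piece is absorbed by the first piece, so that
the descents behind this letter are the ones that count.\<close>

definition tail_wt :: "'a::comm_ring_1 \<Rightarrow> nat list \<Rightarrow> 'a" where
  "tail_wt t \<gamma> = t ^ des (tl \<gamma>)"

text \<open>The relation \<open>R x y a c\<close> says that letters \<open>x\<close> and \<open>y\<close>, in either order, followed by \<open>a\<close> and later by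
\<open>c\<close>, form a forbidden pattern; in each pair below the patterns arise from each other by exchanging
their first two letters, and they end with an ascent. The remaining parameters describe
permutations \<open>us @ 1 # vs\<close> that avoid them. Taking for \<open>a\<close> the letter 1 restricts each letter
\<open>v\<close> of \<open>vs\<close> relative to each letter \<open>u\<close> of \<open>us\<close>, and with \<open>M\<close> the largest letter of \<open>us\<close> the restriction amounts to \<open>fits M u v\<close>. It leaves
one way to interleave the values once it is known how \<open>M\<close> compares with the letters of \<open>vs\<close>: if \<open>us\<close>
has length \<open>k\<close> and \<open>M\<close> has rank \<open>x\<close> in \<open>M # vs\<close>, then \<open>f k x\<close> maps the
standardization of \<open>us\<close> back to \<open>us\<close>, and \<open>g k x\<close> that of \<open>M # vs\<close> back to \<open>M # vs\<close>. Both send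
the letter belonging to \<open>M\<close> to \<open>k + x\<close>.\<close>

locale ascent_class =
  fixes R :: "nat \<Rightarrow> nat \<Rightarrow> nat \<Rightarrow> nat \<Rightarrow> bool"
    and fits :: "nat \<Rightarrow> nat \<Rightarrow> nat \<Rightarrow> bool"
    and f g :: "nat \<Rightarrow> nat \<Rightarrow> nat \<Rightarrow> nat"
  assumes R_map: "\<And>h A x y a c. strict_mono_on A h \<Longrightarrow> x \<in> A \<Longrightarrow> y \<in> A \<Longrightarrow> a \<in> A \<Longrightarrow> c \<in> A \<Longrightarrow>
        R (h x) (h y) (h a) (h c) \<longleftrightarrow> R x y a c"
    and R_less: "\<And>x y a c. R x y a c \<Longrightarrow> a < x \<and> a < y \<and> a < c \<and> c < y"
    and fits_if_not_R: "\<And>M m u v. u \<le> M \<Longrightarrow> m < u \<Longrightarrow> m < v \<Longrightarrow> v \<noteq> M \<Longrightarrow> v \<noteq> u \<Longrightarrow>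
        \<not> R u M m v \<Longrightarrow> fits M u v"
    and not_R_if_fits: "\<And>M x y a v. fits M x v \<Longrightarrow> fits M y v \<Longrightarrow> x \<le> M \<Longrightarrow> y \<le> M \<Longrightarrow> \<not> R x y a v"
    and R_Max_left: "\<And>M x y a v. fits M x v \<Longrightarrow> x \<le> M \<Longrightarrow> R x y a v \<Longrightarrow> R M y a v"
    and R_Max_right: "\<And>M x y a v. fits M y v \<Longrightarrow> y \<le> M \<Longrightarrow> R x y a v \<Longrightarrow> R x M a v"
    and f_mono: "\<And>k x. 0 < x \<Longrightarrow> strict_mono_on {1..k} (f k x)"
    and f_Max: "\<And>k x. 0 < k \<Longrightarrow> f k x k = k + x"
    and g_mono: "\<And>k x. 0 < k \<Longrightarrow> strict_mono_on {1..} (g k x)"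
    and g_first: "\<And>k x. g k x x = k + x"
    and fg_range: "\<And>k x m. 0 < k \<Longrightarrow> x \<in> {1..m} \<Longrightarrow>
        insert 1 (f k x ` {1..k} \<union> g k x ` ({1..m} - {x})) = {1..k + m}"
    and fg_gt_1: "\<And>k x a v. 0 < x \<Longrightarrow> 0 < k \<Longrightarrow> 0 < a \<Longrightarrow> 1 < f k x a \<and> 1 < g k x a"
    and fits_fg: "\<And>k x a v. a \<in> {1..k} \<Longrightarrow> 0 < v \<Longrightarrow> v \<noteq> x \<Longrightarrow> fits (k + x) (f k x a) (g k x v)"
    and f_image_if_fits: "\<And>us vs. perm (us @ 1 # vs) \<Longrightarrow> us \<noteq> [] \<Longrightarrow>
        (\<And>u v. u \<in> set us \<Longrightarrow> v \<in> set vs \<Longrightarrow> fits (Max (set us)) u v) \<Longrightarrow>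
        length us < Max (set us) \<Longrightarrow>
        set us = f (length us) (Max (set us) - length us) ` {1..length us}"
begin

definition av :: "nat list \<Rightarrow> bool" where
  "av \<pi> \<longleftrightarrow> (\<forall>x y a c. before \<pi> x a \<longrightarrow> before \<pi> y a \<longrightarrow> before \<pi> a c \<longrightarrow> \<not> R x y a c)"

lemma avD: "av \<pi> \<Longrightarrow> before \<pi> x a \<Longrightarrow> before \<pi> y a \<Longrightarrow> before \<pi> a c \<Longrightarrow> \<not> R x y a c"
  by (simp add: av_def)

lemma av_map:
  assumes mono: "strict_mono_on (set xs) h"
  shows "av (map h xs) \<longleftrightarrow> av xs"
proof
  assume *: "av (map h xs)"
  show "av xs" unfolding av_def
  proof (intro allI impI)
    fix x y a c assume b: "before xs x a" "before xs y a" "before xs a c"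
    note s = before_in_set[OF b(1)] before_in_set[OF b(2)] before_in_set[OF b(3)]
    have "before (map h xs) (h x) (h a)" "before (map h xs) (h y) (h a)"
      "before (map h xs) (h a) (h c)"
      using b s by (simp_all add: before_map_strict_mono[OF mono])
    from avD[OF * this] show "\<not> R x y a c" using R_map[OF mono] s by simp
  qed
next
  assume *: "av xs"
  show "av (map h xs)" unfolding av_def
  proof (intro allI impI)
    fix X Y A C
    assume b: "before (map h xs) X A" "before (map h xs) Y A" "before (map h xs) A C"
    have "X \<in> h ` set xs" "Y \<in> h ` set xs" "A \<in> h ` set xs" "C \<in> h ` set xs"
      using b before_in_set[of "map h xs"] by (metis list.set_map)+
    then obtain x y a c where e: "X = h x" "Y = h y" "A = h a" "C = h c"
      and s: "x \<in> set xs" "y \<in> set xs" "a \<in> set xs" "c \<in> set xs" by blast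
    have "before xs x a" "before xs y a" "before xs a c"
      using b s unfolding e by (simp_all add: before_map_strict_mono[OF mono])
    from avD[OF * this] show "\<not> R X Y A C" using R_map[OF mono] s unfolding e by simp
  qed
qed

text \<open>In a forbidden pattern \<open>a\<close> is smaller than \<open>x\<close> and \<open>c\<close> is smaller than \<open>y\<close>, so it cannot straddle
the two parts.\<close>

lemma av_append_less:
  assumes lt: "\<And>u v. u \<in> set us \<Longrightarrow> v \<in> set vs \<Longrightarrow> u < v"
  shows "av (us @ vs) \<longleftrightarrow> av us \<and> av vs"
proof
  assume "av us \<and> av vs"
  then have us: "av us" and vs: "av vs" by simp_all
  show "av (us @ vs)" unfolding av_def
  proof (intro allI impI)
    fix x y a c
    assume *: "before (us @ vs) x a" "before (us @ vs) y a" "before (us @ vs) a c"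
    have disj: "x \<in> set us \<Longrightarrow> x \<notin> set vs" for x using lt by blast
    show "\<not> R x y a c"
      using * avD[OF us, of x a y c] avD[OF vs, of x a y c] disj[of a] R_less[of x y a c]
        lt[of y c] lt[of x a]
        before_in_set[of us x a] before_in_set[of us y a] before_in_set[of us a c]
        before_in_set[of vs x a] before_in_set[of vs y a] before_in_set[of vs a c]
        less_asym[of c y] less_asym[of x a]
      unfolding before_append by blast
  qed
qed (auto simp: av_def before_append)

sublocale sum_closed_class av
proof
  show "av [1]" by (simp add: av_def)
next
  fix \<alpha> \<beta> assume "perm \<alpha>" "perm \<beta>"
  then show "av (\<alpha> \<oplus> \<beta>) \<longleftrightarrow> av \<alpha> \<and> av \<beta>"
    unfolding dsum_def using dsum_less[of \<alpha> \<beta>]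
    by (subst av_append_less) (auto simp: av_map)
qed

text \<open>In an occurrence of a forbidden pattern behind \<open>m\<close>, a letter \<open>x\<close> or \<open>y\<close> taken from \<open>us\<close> may be replaced
by the largest letter of \<open>us\<close>, which moves the occurrence into \<open>M # vs\<close>. Occurrences with \<open>x\<close> and \<open>y\<close> in
\<open>us\<close> and \<open>c\<close> in \<open>vs\<close> are exactly what \<open>fits\<close> excludes.\<close>

lemma av_around_minimum:
  assumes dist: "distinct (us @ m # vs)" and "us \<noteq> []"
    and min: "\<And>x. x \<in> set us \<union> set vs \<Longrightarrow> m < x"
  defines "M \<equiv> Max (set us)"
  shows "av (us @ m # vs) \<longleftrightarrow>
    av us \<and> av (M # vs) \<and> (\<forall>u\<in>set us. \<forall>v\<in>set vs. fits M u v)"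
proof -
  have M: "M \<in> set us" "\<And>u. u \<in> set us \<Longrightarrow> u \<le> M" using \<open>us \<noteq> []\<close> by (simp_all add: M_def)
  have b: "before (us @ m # vs) x y \<longleftrightarrow> before us x y \<or> before vs x y \<or>
      (x = m \<and> y \<in> set vs) \<or> (x \<in> set us \<and> (y = m \<or> y \<in> set vs))" for x y
    unfolding before_append before.simps by (simp only: list.set insert_iff) blast
  show ?thesis
  proof (intro iffI conjI ballI)
    assume av: "av (us @ m # vs)"
    show "av us" unfolding av_def
    proof (intro allI impI)
      fix x y a c assume "before us x a" "before us y a" "before us a c"
      then show "\<not> R x y a c" by (intro avD[OF av]) (simp_all add: b)
    qed
    show "av (M # vs)" unfolding av_def
    proof (intro allI impI)
      fix x y a c assume "before (M # vs) x a" "before (M # vs) y a" "before (M # vs) a c"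
      then have "before (us @ m # vs) x a" "before (us @ m # vs) y a" "before (us @ m # vs) a c"
        using M(1) by (auto simp only: b before.simps)
      then show "\<not> R x y a c" by (rule avD[OF av])
    qed
    fix u v assume uv: "u \<in> set us" "v \<in> set vs"
    have "\<not> R u M m v" by (rule avD[OF av]) (use uv M(1) in \<open>simp_all add: b\<close>)
    then show "fits M u v" using uv M min dist by (intro fits_if_not_R) auto
  next
    assume *: "av us \<and> av (M # vs) \<and> (\<forall>u\<in>set us. \<forall>v\<in>set vs. fits M u v)"
    then have av: "av us" "av (M # vs)" and fits: "\<And>u v. u \<in> set us \<Longrightarrow> v \<in> set vs \<Longrightarrow> fits M u v"
      by blast+
    show "av (us @ m # vs)" unfolding av_def
    proof (intro allI impI notI)
      fix x y a c
      assume xa: "before (us @ m # vs) x a" and ya: "before (us @ m # vs) y a"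
        and ac: "before (us @ m # vs) a c" and R: "R x y a c"
      have in_word: "x \<in> set (us @ m # vs)" "y \<in> set (us @ m # vs)" "a \<in> set (us @ m # vs)"
        "c \<in> set (us @ m # vs)"
        using before_in_set[OF xa] before_in_set[OF ya] before_in_set[OF ac] by blast+
      have "m \<le> a" using in_word(3) min[of a] by auto
      then have not_m: "x \<noteq> m" "y \<noteq> m" "c \<noteq> m" using R_less[OF R] by auto
      show False
      proof (cases "a \<in> set vs")
        case True
        then have "a \<notin> set us" "a \<noteq> m" using dist by auto
        then have ac': "before vs a c" using ac before_in_set[of us a c] by (auto simp: b)
        then have c: "c \<in> set vs" using before_in_set[of vs a c] by simp
        have before_a: "(before vs z a \<or> z \<in> set us)" if "before (us @ m # vs) z a" "z \<noteq> m" for z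
          using that \<open>a \<notin> set us\<close> before_in_set[of us z a] by (auto simp: b)
        \<comment> \<open>Moves a letter of \<open>us\<close> to the front letter of \<open>M # vs\<close>.\<close>
        define lift where "lift z = (if z \<in> set us then M else z)" for z
        have "before (M # vs) (lift x) a" "before (M # vs) (lift y) a" "before (M # vs) a c"
          using before_a[OF xa not_m(1)] before_a[OF ya not_m(2)] True ac' by (auto simp: lift_def)
        then have "\<not> R (lift x) (lift y) a c" by (rule avD[OF av(2)])
        moreover have "R (lift x) y a c"
          using R R_Max_left[OF fits M(2)] c by (auto simp: lift_def)
        then have "R (lift x) (lift y) a c"
          using R_Max_right[OF fits M(2)] c by (auto simp: lift_def)
        ultimately show False by blast
      next
        case False
        then have xy: "x \<in> set us" "y \<in> set us"
          using xa ya not_m before_in_set[of us x a] before_in_set[of us y a]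
            before_in_set[of vs x a] before_in_set[of vs y a] by (auto simp: b)
        show False
        proof (cases "c \<in> set vs")
          case True
          then show False using not_R_if_fits[OF fits fits M(2) M(2)] xy R by blast
        next
          case c: False
          then have "before us a c"
            using ac not_m before_in_set[of vs a c] by (auto simp: b)
          moreover from this have "a \<in> set us" using before_in_set[of us a c] by simp
          then have "a \<noteq> m" using dist by auto
          then have "before us x a" "before us y a"
            using xa ya False before_in_set[of vs x a] before_in_set[of vs y a] by (auto simp: b)
          ultimately show False using avD[OF av(1)] R by blast
        qed
      qed
    qed
  qed
qed

text \<open>The first letter of \<open>\<gamma>\<close> is replaced by a block ordered like \<open>\<alpha>\<close>, whose maximum takes over its role, and
the new smallest letter 1 is inserted behind the block.\<close>

definition glue :: "nat list \<Rightarrow> nat list \<Rightarrow> nat list" where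
  "glue \<alpha> \<gamma> = map (f (length \<alpha>) (hd \<gamma>)) \<alpha> @ 1 # map (g (length \<alpha>) (hd \<gamma>)) (tl \<gamma>)"

context
  fixes \<alpha> \<gamma> :: "nat list" and k x :: nat and us vs
  assumes \<alpha>: "perm \<alpha>" "\<alpha> \<noteq> []" and \<gamma>: "perm \<gamma>" "\<gamma> \<noteq> []"
  defines "k \<equiv> length \<alpha>" and "x \<equiv> hd \<gamma>"
    and "us \<equiv> map (f k x) \<alpha>" and "vs \<equiv> map (g k x) (tl \<gamma>)"
begin

lemma glue_eq: "glue \<alpha> \<gamma> = us @ 1 # vs"
  by (simp add: glue_def us_def vs_def k_def x_def)

lemma kx: "0 < k" "x \<in> {1..length \<gamma>}" "0 < x"
proof -
  have "x \<in> set \<gamma>" using \<gamma>(2) by (simp add: x_def)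
  then show "x \<in> {1..length \<gamma>}" using \<gamma>(1) by (simp add: perm_def)
  then show "0 < x" by simp
  show "0 < k" using \<alpha>(2) by (simp add: k_def)
qed

lemma set_tl: "set (tl \<gamma>) = {1..length \<gamma>} - {x}"
  using \<gamma> by (cases \<gamma>) (auto simp: perm_def x_def)

lemma set_\<alpha>: "set \<alpha> = {1..k}"
  using \<alpha>(1) by (simp add: perm_def k_def)

lemma f_mono_\<alpha>: "strict_mono_on (set \<alpha>) (f k x)"
  unfolding set_\<alpha> by (rule f_mono[OF kx(3)])

lemma g_mono_\<gamma>: "strict_mono_on (set \<gamma>) (g k x)"
  using g_mono[OF kx(1)] \<gamma>(1) by (auto simp: perm_def strict_mono_on_def)

lemma g_mono_tl: "strict_mono_on (set (tl \<gamma>)) (g k x)"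
  using g_mono_\<gamma> list.set_sel(2)[OF \<gamma>(2)] by (auto simp: strict_mono_on_def)

lemma glue_gt_1: "y \<in> set us \<union> set vs \<Longrightarrow> 1 < y"
  using fg_gt_1[OF kx(3,1)] set_\<alpha> set_tl by (auto simp: us_def vs_def)

lemma Max_us: "Max (set us) = k + x"
proof (rule Max_eqI)
  show "k + x \<in> set us" using f_Max[OF kx(1), of x] kx(1) set_\<alpha> by (force simp: us_def)
  fix y assume "y \<in> set us"
  then obtain a where "y = f k x a" "a \<in> {1..k}" using set_\<alpha> by (auto simp: us_def)
  then show "y \<le> k + x"
    using strict_mono_onD[OF f_mono[OF kx(3)], of a k k] f_Max[OF kx(1), of x]
    by (cases "a = k") auto
qed simp

lemma Max_Cons_vs: "Max (set us) # vs = map (g k x) \<gamma>"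
  using \<gamma>(2) g_first[of k x] unfolding Max_us vs_def x_def by (cases \<gamma>) auto

lemma length_glue: "length (glue \<alpha> \<gamma>) = length \<alpha> + length \<gamma>"
  using \<gamma>(2) by (cases \<gamma>) (simp_all add: glue_def)

lemma perm_glue: "perm (glue \<alpha> \<gamma>)"
proof (rule permI)
  have "set (glue \<alpha> \<gamma>) = insert 1 (f k x ` {1..k} \<union> g k x ` ({1..length \<gamma>} - {x}))"
    unfolding glue_eq us_def vs_def using set_\<alpha> set_tl by auto
  then show "set (glue \<alpha> \<gamma>) = {1..length (glue \<alpha> \<gamma>)}"
    using fg_range[OF kx(1,2)] by (simp add: length_glue k_def)
qed

lemma av_glue: "av (glue \<alpha> \<gamma>) \<longleftrightarrow> av \<alpha> \<and> av \<gamma>"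
proof -
  have "fits (k + x) u v" if "u \<in> set us" "v \<in> set vs" for u v
    using that set_\<alpha> set_tl fits_fg by (auto simp: us_def vs_def)
  moreover have "distinct (us @ 1 # vs)" using perm_glue by (simp add: perm_def glue_eq)
  moreover have "us \<noteq> []" using \<alpha>(2) by (simp add: us_def)
  ultimately have "av (glue \<alpha> \<gamma>) \<longleftrightarrow> av us \<and> av (Max (set us) # vs)"
    unfolding glue_eq using av_around_minimum[of us 1 vs] glue_gt_1 Max_us by simp
  then show ?thesis
    unfolding Max_Cons_vs using av_map[OF f_mono_\<alpha>] av_map[OF g_mono_\<gamma>] by (simp add: us_def)
qed

lemma splits_glue: "splits (<) (glue \<alpha> \<gamma>) \<longleftrightarrow> splits (<) \<gamma>"
proof -
  have "splits (<) (glue \<alpha> \<gamma>) \<longleftrightarrow> splits (<) (Max (set us) # vs)"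
    unfolding glue_eq using \<alpha>(2) glue_gt_1 by (intro splits_around_minimum) (auto simp: us_def)
  then show ?thesis unfolding Max_Cons_vs by (simp add: splits_less_map[OF g_mono_\<gamma>])
qed

lemma des_Cons_1_vs: "des (1 # vs) = des (tl \<gamma>)"
proof -
  have "des (1 # vs) = des vs" by (rule des_Cons_less) (rule glue_gt_1, simp)
  then show ?thesis by (simp add: vs_def des_map[OF g_mono_tl])
qed

lemma last_us: "1 < last us"
proof (rule glue_gt_1)
  have "us \<noteq> []" using \<alpha>(2) by (simp add: us_def)
  then show "last us \<in> set us \<union> set vs" by simp
qed

lemma des_glue: "des (glue \<alpha> \<gamma>) = des \<alpha> + 1 + des (tl \<gamma>)"
  unfolding glue_eq using \<alpha>(2) last_us des_Cons_1_vs
  by (subst des_append) (simp_all add: us_def des_map[OF f_mono_\<alpha>])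

lemma iar_glue: "iar (glue \<alpha> \<gamma>) = iar \<alpha>"
  unfolding glue_eq using \<alpha>(2) last_us
  by (subst iar_append_descent) (simp_all add: us_def iar_map[OF f_mono_\<alpha>])

text \<open>Only for \<open>\<alpha> = [1]\<close> the descent to the letter 1 starts at the first letter and is lost with it.\<close>

lemma des_tl_glue:
  "des (tl (glue \<alpha> \<gamma>)) = (if \<alpha> = [1] then 0 else des (tl \<alpha>) + 1) + des (tl \<gamma>)"
proof -
  have "us \<noteq> []" using \<alpha>(2) by (simp add: us_def)
  then have tl_glue: "tl (glue \<alpha> \<gamma>) = tl us @ 1 # vs" unfolding glue_eq by simp
  show ?thesis
  proof (cases "tl \<alpha> = []")
    case True
    then have "length \<alpha> = 1" using \<alpha>(2) by (cases \<alpha>) auto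
    then have "\<alpha> = [1]" using \<alpha>(1) by (cases \<alpha>) auto
    moreover have "tl us = []" using True by (simp add: us_def flip: map_tl)
    ultimately show ?thesis unfolding tl_glue using des_Cons_1_vs by simp
  next
    case False
    have "strict_mono_on (set (tl \<alpha>)) (f k x)"
      using f_mono_\<alpha> list.set_sel(2)[OF \<alpha>(2)] by (auto simp: strict_mono_on_def)
    then have "des (tl us) = des (tl \<alpha>)" by (simp add: us_def des_map flip: map_tl)
    moreover have "tl us \<noteq> []" using False by (simp add: us_def flip: map_tl)
    moreover from this have "1 < last (tl us)" using last_us by (simp add: last_tl)
    ultimately have "des (tl us @ 1 # vs) = des (tl \<alpha>) + 1 + des (tl \<gamma>)"
      using des_Cons_1_vs by (subst des_append) simp_all
    moreover have "\<alpha> \<noteq> [1]" using False by auto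
    ultimately show ?thesis unfolding tl_glue by simp
  qed
qed

end

lemma glue_inj:
  assumes "perm \<alpha>" "\<alpha> \<noteq> []" "perm \<gamma>" "\<gamma> \<noteq> []" "perm \<alpha>'" "\<alpha>' \<noteq> []" "perm \<gamma>'" "\<gamma>' \<noteq> []"
    and eq: "glue \<alpha> \<gamma> = glue \<alpha>' \<gamma>'"
  shows "\<alpha> = \<alpha>' \<and> \<gamma> = \<gamma>'"
proof -
  define us vs where "us = map (f (length \<alpha>) (hd \<gamma>)) \<alpha>" and "vs = map (g (length \<alpha>) (hd \<gamma>)) (tl \<gamma>)"
  define us' vs' where "us' = map (f (length \<alpha>') (hd \<gamma>')) \<alpha>'"
    and "vs' = map (g (length \<alpha>') (hd \<gamma>')) (tl \<gamma>')"
  note l = assms(1-4) and r = assms(5-8)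
  have "1 \<notin> set us" "1 \<notin> set vs"
    using glue_gt_1[OF l, of 1] unfolding us_def vs_def by auto
  moreover have "us @ 1 # vs = us' @ 1 # vs'"
    using eq unfolding glue_def us_def us'_def vs_def vs'_def .
  ultimately have e: "us = us'" "vs = vs'" by (simp_all add: append_Cons_eq_iff)
  have k: "length \<alpha>' = length \<alpha>" using arg_cong[OF e(1), of length] by (simp add: us_def us'_def)
  have x: "hd \<gamma>' = hd \<gamma>"
    using Max_us[OF l] Max_us[OF r] e(1) unfolding us_def us'_def k by simp
  have f: "inj_on (f (length \<alpha>) (hd \<gamma>)) {1..length \<alpha>}"
    by (rule strict_mono_on_imp_inj_on[OF f_mono[OF kx(3)[OF l]]])
  have "set \<alpha> \<union> set \<alpha>' = {1..length \<alpha>}" using l(1) r(1) k unfolding perm_def by simp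
  moreover have "map (f (length \<alpha>) (hd \<gamma>)) \<alpha> = map (f (length \<alpha>) (hd \<gamma>)) \<alpha>'"
    using e(1) unfolding us_def us'_def k x .
  ultimately have "\<alpha> = \<alpha>'" using f map_inj_on by metis
  have "map (g (length \<alpha>) (hd \<gamma>)) \<gamma> = map (g (length \<alpha>) (hd \<gamma>)) \<gamma>'"
    using Max_Cons_vs[OF l] Max_Cons_vs[OF r] e unfolding us_def us'_def vs_def vs'_def k x
    by (simp only:)
  moreover have "inj_on (g (length \<alpha>) (hd \<gamma>)) (set \<gamma> \<union> set \<gamma>')"
    by (rule inj_on_subset[OF strict_mono_on_imp_inj_on[OF g_mono[OF kx(1)[OF l]]]])
       (use l(3) r(3) in \<open>auto simp: perm_def\<close>)
  ultimately have "\<gamma> = \<gamma>'" by (rule map_inj_on)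
  then show ?thesis using \<open>\<alpha> = \<alpha>'\<close> by simp
qed

text \<open>Cut \<open>\<pi>\<close> at its letter 1. The part in front is nonempty, since otherwise \<open>\<pi>\<close> splits behind the 1.
Its value set is determined by its length and its largest letter \<open>M\<close>, which makes both parts images
under \<open>f k x\<close> and \<open>g k x\<close>, with \<open>x = M - k\<close> forced by \<open>f k x k = k + x\<close>.\<close>

lemma glue_surj:
  assumes "perm \<pi>" "av \<pi>" "2 \<le> length \<pi>" "\<not> splits (<) \<pi>"
  obtains \<alpha> \<gamma> where "perm \<alpha>" "\<alpha> \<noteq> []" "perm \<gamma>" "\<gamma> \<noteq> []" "\<pi> = glue \<alpha> \<gamma>"
proof -
  have "1 \<in> set \<pi>" using assms(1,3) by (simp add: perm_def)
  then obtain us vs where \<pi>: "\<pi> = us @ 1 # vs" by (meson split_list)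
  have dist: "distinct (us @ 1 # vs)" using assms(1) \<pi> by (simp add: perm_def)
  have min: "1 < y" if "y \<in> set us \<union> set vs" for y
  proof -
    have "0 < y" "y \<noteq> 1" using perm_pos[OF assms(1), of y] that dist unfolding \<pi> by auto
    then show ?thesis by simp
  qed
  have "us \<noteq> []"
  proof
    assume "us = []"
    then have "\<pi> = [1] @ vs" "vs \<noteq> []" using \<pi> assms(3) by auto
    then have "splits (<) \<pi>" using min by (auto intro!: splitsI simp del: append.simps)
    then show False using assms(4) by simp
  qed
  define M k x where "M = Max (set us)" and "k = length us" and "x = M - k"
  define m where "m = Suc (length vs)"
  have len: "length \<pi> = k + m" by (simp add: \<pi> k_def m_def)
  have M: "M \<in> set us" using \<open>us \<noteq> []\<close> by (simp add: M_def)
  have fits: "fits M u v" if "u \<in> set us" "v \<in> set vs" for u v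
    using assms(2) av_around_minimum[OF dist \<open>us \<noteq> []\<close> min] that unfolding \<pi> M_def by blast
  have "card (set us) \<le> card {2..M}"
  proof (rule card_mono)
    show "set us \<subseteq> {2..M}"
    proof
      fix y assume "y \<in> set us"
      then show "y \<in> {2..M}" using min[of y] by (simp add: M_def)
    qed
  qed simp
  then have "k < M" using dist min[of M] M by (simp add: k_def distinct_card)
  have "0 < k" using \<open>us \<noteq> []\<close> by (simp add: k_def)
  have "M \<le> k + m" using perm_pos[OF assms(1), of M] M len unfolding \<pi> by simp
  then have x: "x \<in> {1..m}" using \<open>k < M\<close> by (auto simp: x_def)
  have us: "set us = f k x ` {1..k}"
    unfolding k_def x_def M_def
    by (rule f_image_if_fits) (use assms(1) \<pi> \<open>us \<noteq> []\<close> fits \<open>k < M\<close> in \<open>simp_all add: k_def M_def\<close>)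
  have "set vs \<subseteq> {1..k + m} - insert 1 (set us)"
    using assms(1) dist len unfolding \<pi> perm_def by auto
  also have "\<dots> \<subseteq> g k x ` ({1..m} - {x})" using fg_range[OF \<open>0 < k\<close> x] us by blast
  finally obtain \<beta> where \<beta>: "set \<beta> \<subseteq> {1..m} - {x}" "vs = map (g k x) \<beta>" by (rule map_preimage)
  have "set us \<subseteq> f k x ` {1..k}" using us by simp
  then obtain \<alpha> where \<alpha>: "set \<alpha> \<subseteq> {1..k}" "us = map (f k x) \<alpha>" by (rule map_preimage)
  have "length \<alpha> = k" using arg_cong[OF \<alpha>(2), of length] by (simp only: k_def length_map)
  have "perm \<alpha>"
    using \<alpha>(1) dist unfolding \<alpha>(2) \<open>length \<alpha> = k\<close>[symmetric]
    by (intro perm_if_distinct_subset) (simp_all add: distinct_map)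
  moreover have "perm (x # \<beta>)"
  proof (rule perm_if_distinct_subset)
    show "distinct (x # \<beta>)" using \<beta>(1) dist unfolding \<beta>(2) by (auto simp: distinct_map)
    have "length \<beta> = length vs" using arg_cong[OF \<beta>(2), of length] by simp
    then show "set (x # \<beta>) \<subseteq> {1..length (x # \<beta>)}" using \<beta>(1) x by (auto simp: m_def)
  qed
  moreover have "\<pi> = glue \<alpha> (x # \<beta>)"
    using \<alpha>(2) \<beta>(2) \<open>length \<alpha> = k\<close> by (simp add: glue_def \<pi>)
  moreover have "\<alpha> \<noteq> []" using \<open>0 < k\<close> \<open>length \<alpha> = k\<close> by auto
  ultimately show ?thesis using that[of \<alpha> "x # \<beta>"] by simp
qed

lemma glue_image: "(\<lambda>(\<alpha>, \<gamma>). glue \<alpha> \<gamma>) ` (nonempty \<times> indecomposables) = proper_indecomposables"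
proof (intro equalityI subsetI)
  fix \<pi> assume "\<pi> \<in> (\<lambda>(\<alpha>, \<gamma>). glue \<alpha> \<gamma>) ` (nonempty \<times> indecomposables)"
  then obtain \<alpha> \<gamma> where \<pi>: "\<pi> = glue \<alpha> \<gamma>" "\<alpha> \<in> nonempty" "\<gamma> \<in> indecomposables"
    by (auto simp only: image_iff mem_Times_iff split: prod.splits)
  then have p: "perm \<alpha>" "\<alpha> \<noteq> []" "perm \<gamma>" "\<gamma> \<noteq> []"
    and q: "av \<alpha>" "av \<gamma>" "\<not> splits (<) \<gamma>"
    using nonemptyD[of \<alpha>] by (simp_all add: indecomposables_iff)
  have "2 \<le> length \<alpha> + length \<gamma>" using p(2,4) by (cases \<alpha>; cases \<gamma>) simp_all
  then show "\<pi> \<in> proper_indecomposables"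
    unfolding proper_indecomposables_iff \<pi>(1)
    using q perm_glue[OF p] av_glue[OF p] splits_glue[OF p] length_glue[OF p] by simp
next
  fix \<pi> assume "\<pi> \<in> proper_indecomposables"
  then have \<pi>: "perm \<pi>" "av \<pi>" "2 \<le> length \<pi>" "\<not> splits (<) \<pi>"
    by (simp_all add: proper_indecomposables_iff)
  then obtain \<alpha> \<gamma> where p: "perm \<alpha>" "\<alpha> \<noteq> []" "perm \<gamma>" "\<gamma> \<noteq> []" and g: "\<pi> = glue \<alpha> \<gamma>"
    by (rule glue_surj) blast
  have "\<alpha> \<in> nonempty" "\<gamma> \<in> indecomposables"
    using p \<pi>(2,4) av_glue[OF p] splits_glue[OF p] unfolding g
    by (simp_all add: indecomposables_iff nonempty_def members_def)
  then show "\<pi> \<in> (\<lambda>(\<alpha>, \<gamma>). glue \<alpha> \<gamma>) ` (nonempty \<times> indecomposables)"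
    unfolding g by (intro image_eqI[of _ _ "(\<alpha>, \<gamma>)"]) simp_all
qed

lemma glue_inj_on: "inj_on (\<lambda>(\<alpha>, \<gamma>). glue \<alpha> \<gamma>) (nonempty \<times> indecomposables)"
proof (rule inj_onI, clarify)
  fix \<alpha> \<gamma> \<alpha>' \<gamma>'
  assume "\<alpha> \<in> nonempty" "\<alpha>' \<in> nonempty" "\<gamma> \<in> indecomposables" "\<gamma>' \<in> indecomposables"
    and eq: "glue \<alpha> \<gamma> = glue \<alpha>' \<gamma>'"
  then show "\<alpha> = \<alpha>' \<and> \<gamma> = \<gamma>'"
    by (intro glue_inj[OF _ _ _ _ _ _ _ _ eq]) (auto simp: indecomposables_iff dest: nonemptyD)
qed

lemma glue_factorization:
  "wgf proper_indecomposables (wt t r 1) =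
     fps_const t * wgf nonempty (wt t r 1) * wgf indecomposables (tail_wt t)"
proof -
  have "wgf proper_indecomposables (wt t r 1) =
      wgf nonempty (\<lambda>\<alpha>. t * wt t r 1 \<alpha>) * wgf indecomposables (tail_wt t)"
    unfolding glue_image[symmetric]
  proof (rule wgf_product[OF glue_inj_on])
    fix \<alpha> \<gamma> assume "\<alpha> \<in> nonempty" "\<gamma> \<in> indecomposables"
    then have p: "perm \<alpha>" "\<alpha> \<noteq> []" "perm \<gamma>" "\<gamma> \<noteq> []"
      by (auto simp: indecomposables_iff dest: nonemptyD)
    show "wt t r 1 (glue \<alpha> \<gamma>) = t * wt t r 1 \<alpha> * tail_wt t \<gamma>"
      by (simp add: wt_def tail_wt_def des_glue[OF p] iar_glue[OF p] power_add mult_ac)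
    show "length (glue \<alpha> \<gamma>) = length \<alpha> + length \<gamma>" by (rule length_glue[OF p])
  qed simp_all
  then show ?thesis by (simp add: wgf_scale)
qed

text \<open>The first letter lies in the first component, and there is no descent between components.\<close>

lemma tail_nonempty:
  "wgf nonempty (tail_wt t) = wgf indecomposables (tail_wt t) * wgf members (wt t 1 1)"
  unfolding dsum_image_indecomposables[symmetric]
proof (rule wgf_product[OF dsum_inj_on])
  fix \<alpha> \<beta> assume "\<alpha> \<in> indecomposables" "\<beta> \<in> members"
  then have p: "perm \<alpha>" "\<alpha> \<noteq> []" "perm \<beta>" by (simp_all add: indecomposables_iff members_def)
  let ?\<beta> = "map ((+) (length \<alpha>)) \<beta>"
  have \<beta>: "des ?\<beta> = des \<beta>" by (simp add: des_map)
  have "des (tl \<alpha> @ ?\<beta>) = des (tl \<alpha>) + des \<beta>"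
  proof (cases "tl \<alpha> = [] \<or> \<beta> = []")
    case True
    then show ?thesis using \<beta> by auto
  next
    case False
    then have "last (tl \<alpha>) = last \<alpha>" by (simp add: last_tl)
    then have "last (tl \<alpha>) < hd ?\<beta>"
      using False p dsum_less[OF p(1,3), of "last \<alpha>" "hd ?\<beta>"] hd_in_set[of ?\<beta>] by simp
    then show ?thesis using False \<beta> by (subst des_append) simp_all
  qed
  then show "tail_wt t (\<alpha> \<oplus> \<beta>) = tail_wt t \<alpha> * wt t 1 1 \<beta>"
    using p(2) by (simp add: dsum_def tail_wt_def power_add)
qed simp_all

text \<open>The three terms belong to the one-letter permutation, to a single letter glued to \<open>\<gamma>\<close>, and to gluings
\<open>glue \<alpha> \<gamma>\<close> with \<open>\<alpha>\<close> of length at least 2.\<close>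

lemma tail_indecomposables:
  fixes t :: "'b::comm_ring_1"
  defines "U \<equiv> wgf indecomposables (tail_wt t)" and "W \<equiv> wgf nonempty (tail_wt t)"
  shows "U = fps_X + fps_X * U + fps_const t * (W - fps_X) * U"
proof -
  let ?h = "\<lambda>(\<alpha>, \<gamma>). glue \<alpha> \<gamma>" and ?I = indecomposables and ?N = "nonempty - {[1]}"
  have one: "[1] \<in> nonempty" using av_one by (simp add: nonempty_def members_def)
  have g1: "finite_lengthwise {[1]}" by (rule finite_lengthwise_perms) simp
  have gN: "finite_lengthwise ?N" by (rule finite_lengthwise_subset[of nonempty]) auto
  have tail_one: "tail_wt t [1] = 1" by (simp add: tail_wt_def)
  have W: "W = fps_X + wgf ?N (tail_wt t)"
  proof -
    have "nonempty = {[1]} \<union> ?N" using one by blast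
    then have "W = wgf ({[1]} \<union> ?N) (tail_wt t)" by (simp add: W_def)
    also have "\<dots> = wgf {[1]} (tail_wt t) + wgf ?N (tail_wt t)" by (rule wgf_Un[OF g1 gN]) blast
    finally show ?thesis using tail_one by (simp add: wgf_single)
  qed
  have sub: "{[1]} \<times> ?I \<subseteq> nonempty \<times> ?I" "?N \<times> ?I \<subseteq> nonempty \<times> ?I" using one by blast+
  have "nonempty \<times> ?I = {[1]} \<times> ?I \<union> ?N \<times> ?I" using one by blast
  then have dec: "proper_indecomposables = ?h ` ({[1]} \<times> ?I) \<union> ?h ` (?N \<times> ?I)"
    unfolding glue_image[symmetric] by (simp only: image_Un)
  have "({[1]} \<times> ?I) \<inter> (?N \<times> ?I) = {}" by blast
  then have disj: "?h ` ({[1]} \<times> ?I) \<inter> ?h ` (?N \<times> ?I) = {}"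
    by (simp only: inj_on_image_Int[OF glue_inj_on sub, symmetric] image_empty)
  have gr: "finite_lengthwise (?h ` ({[1]} \<times> ?I))" "finite_lengthwise (?h ` (?N \<times> ?I))"
    by (rule finite_lengthwise_subset[of proper_indecomposables], simp, simp only: dec, blast)+
  have glued: "tail_wt t (glue \<alpha> \<gamma>) = (if \<alpha> = [1] then 1 else t * tail_wt t \<alpha>) * tail_wt t \<gamma>"
    "length (glue \<alpha> \<gamma>) = length \<alpha> + length \<gamma>" if "\<alpha> \<in> nonempty" "\<gamma> \<in> ?I" for \<alpha> \<gamma>
  proof -
    have p: "perm \<alpha>" "\<alpha> \<noteq> []" "perm \<gamma>" "\<gamma> \<noteq> []"
      using that by (auto simp: indecomposables_iff dest: nonemptyD)
    show "tail_wt t (glue \<alpha> \<gamma>) = (if \<alpha> = [1] then 1 else t * tail_wt t \<alpha>) * tail_wt t \<gamma>"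
      by (simp add: tail_wt_def des_tl_glue[OF p] power_add)
    show "length (glue \<alpha> \<gamma>) = length \<alpha> + length \<gamma>" by (rule length_glue[OF p])
  qed
  have "wgf (?h ` ({[1]} \<times> ?I)) (tail_wt t) = wgf {[1]} (\<lambda>_. 1) * U"
    unfolding U_def
    by (rule wgf_product[OF inj_on_subset[OF glue_inj_on sub(1)] g1 finite_lengthwise_classes(3)])
       (use glued[OF one] in auto)
  moreover have "wgf (?h ` (?N \<times> ?I)) (tail_wt t) = wgf ?N (\<lambda>\<alpha>. t * tail_wt t \<alpha>) * U"
    unfolding U_def
    by (rule wgf_product[OF inj_on_subset[OF glue_inj_on sub(2)] gN finite_lengthwise_classes(3)])
       (use glued in auto)
  ultimately have proper: "wgf proper_indecomposables (tail_wt t) = fps_X * U + fps_const t * (W - fps_X) * U"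
    unfolding dec wgf_Un[OF gr disj] W by (simp add: wgf_single wgf_scale)
  have "U = wgf {[1]} (tail_wt t) + wgf proper_indecomposables (tail_wt t)"
    unfolding U_def indecomposables_eq
    by (rule wgf_Un[OF g1 finite_lengthwise_classes(4)]) (simp add: proper_indecomposables_def)
  then show ?thesis unfolding proper using tail_one by (simp add: wgf_single algebra_simps)
qed

text \<open>With \<open>W = U (1 + S)\<close>, multiply \<open>U = z + z U + t (W - z) U\<close> by \<open>S\<close> and replace \<open>t S U (1 + S)\<close> by
\<open>S - z (1 + S)\<close>, which is the equation for the first component. All terms but multiples of \<open>z\<close> cancel,
and division by \<open>z\<close> leaves the claim.\<close>

lemma tail_equation:
  fixes t :: "'b::field"
  defines "U \<equiv> wgf indecomposables (tail_wt t)" and "S \<equiv> wgf nonempty (wt t 1 1)"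
  shows "U * (1 + fps_const t * S) = S"
proof -
  have S: "S = fps_X * (1 + S) + fps_const t * S * U * (1 + S)"
    using wgf_nonempty_wt[of t 1 1] unfolding glue_factorization by (simp add: wgf_members S_def U_def)
  have U: "U = fps_X + fps_X * U + fps_const t * (U * (1 + S) - fps_X) * U"
    using tail_indecomposables[of t] unfolding tail_nonempty by (simp add: wgf_members S_def U_def)
  have "fps_X * (U * (1 + fps_const t * S)) = fps_X * S"
    using S U by algebra
  then show ?thesis by simp
qed

end

section \<open>The classes avoiding 2413, 4213 and 3412, 4312\<close>

abbreviation pattern_2413_4213 :: "nat \<Rightarrow> nat \<Rightarrow> nat \<Rightarrow> nat \<Rightarrow> bool" where
  "pattern_2413_4213 x y a c \<equiv> a < x \<and> x < c \<and> c < y"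

abbreviation pattern_3412_4312 :: "nat \<Rightarrow> nat \<Rightarrow> nat \<Rightarrow> nat \<Rightarrow> bool" where
  "pattern_3412_4312 x y a c \<equiv> a < c \<and> c < x \<and> c < y \<and> x \<noteq> y"

lemma shift_image: "(\<lambda>a. a + x) ` {1..k} = {x + 1..x + (k :: nat)}"
  by (simp add: add.commute)

text \<open>A letter behind the 1 may not lie between two letters in front of it, so the letters in front of the 1
are \<open>k\<close> consecutive numbers \<open>x + 1, \<dots>, x + k\<close>. They act like a single letter of value \<open>x\<close> for
everything behind the 1: below this block \<open>g\<close> only makes room for the 1, above it also for the
\<open>k - 1\<close> further letters of the block.\<close>

interpretation pattern_2413_4213: ascent_class pattern_2413_4213
  "\<lambda>M u v. u < v \<longleftrightarrow> M < v" "\<lambda>k x a. a + x" "\<lambda>k x v. if v < x then v + 1 else v + k"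
proof
  fix k x m :: nat assume k: "0 < k" and x: "x \<in> {1..m}"
  let ?g = "\<lambda>v. if v < x then v + 1 else v + k"
  have "?g ` ({1..m} - {x}) = {2..x} \<union> {x + k + 1..k + m}"
  proof (intro equalityI subsetI)
    fix w assume "w \<in> {2..x} \<union> {x + k + 1..k + m}"
    then consider "2 \<le> w" "w \<le> x" | "x + k < w" "w \<le> k + m" by fastforce
    then show "w \<in> ?g ` ({1..m} - {x})"
    proof cases
      case 1
      then show ?thesis using x by (intro image_eqI[of _ _ "w - 1"]) auto
    next
      case 2
      then show ?thesis by (intro image_eqI[of _ _ "w - k"]) auto
    qed
  qed (use k x in \<open>auto split: if_splits\<close>)
  then show "insert 1 ((\<lambda>a. a + x) ` {1..k} \<union> ?g ` ({1..m} - {x})) = {1..k + m}"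
    unfolding shift_image using k x by auto
next
  fix us vs :: "nat list"
  let ?M = "Max (set us)"
  assume perm: "perm (us @ 1 # vs)" and us: "us \<noteq> []"
    and fits: "\<And>u v. u \<in> set us \<Longrightarrow> v \<in> set vs \<Longrightarrow> u < v \<longleftrightarrow> ?M < v"
    and "length us < ?M"
  have M: "?M \<in> set us" using us by simp
  \<comment> \<open>A value between the extreme letters of \<open>us\<close> that is missing from \<open>us\<close> would occur in \<open>vs\<close>.\<close>
  define l where "l = Min (set us)"
  have l: "l \<in> set us" using us by (simp add: l_def)
  have "set us = {l..?M}"
  proof (intro equalityI subsetI)
    fix v assume v: "v \<in> {l..?M}"
    show "v \<in> set us"
    proof (rule ccontr)
      assume "v \<notin> set us"
      have "l \<noteq> 1" "0 < l" "?M \<le> length (us @ 1 # vs)"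
        using perm perm_pos[OF perm, of l] perm_pos[OF perm, of ?M] l M by (auto simp: perm_def)
      then have "v \<in> set (us @ 1 # vs)" "v \<noteq> 1" using v perm unfolding perm_def by auto
      then have "v \<in> set vs" using \<open>v \<notin> set us\<close> by simp
      moreover have "l < v" using v l \<open>v \<notin> set us\<close> by (cases "l = v") auto
      ultimately have "?M < v" using fits l by blast
      then show False using v by simp
    qed
  qed (simp add: l_def)
  moreover from this have "length us = ?M + 1 - l"
    using perm by (metis card_atLeastAtMost Suc_eq_plus1 distinct_append distinct_card perm_def)
  moreover have "l \<le> ?M" using M by (simp add: l_def)
  ultimately show "set us = (\<lambda>a. a + (?M - length us)) ` {1..length us}"
    unfolding shift_image using \<open>length us < ?M\<close> by simp
qed (auto simp: strict_mono_on_def strict_mono_on_less_iff split: if_splits)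

text \<open>A letter behind the 1 is exceeded by at most one letter in front of it, so the letters in front of the
1 except for their maximum are \<open>2, \<dots>, k\<close>. The maximum exceeds them by an arbitrary amount: it has value
\<open>k + x\<close>, where \<open>x\<close> is its rank among itself and the letters behind the 1.\<close>

interpretation pattern_3412_4312: ascent_class pattern_3412_4312
  "\<lambda>M u v. u \<noteq> M \<longrightarrow> u < v" "\<lambda>k x a. if a < k then a + 1 else k + x" "\<lambda>k x v. k + v"
proof
  fix k x m :: nat assume k: "0 < k" and x: "x \<in> {1..m}"
  let ?f = "\<lambda>a. if a < k then a + 1 else k + x"
  show "insert 1 (?f ` {1..k} \<union> (+) k ` ({1..m} - {x})) = {1..k + m}"
  proof (intro equalityI subsetI)
    fix w assume w: "w \<in> {1..k + m}"
    then consider "w = 1" | "2 \<le> w" "w \<le> k" | "w = k + x" | "k < w" "w \<noteq> k + x" by fastforce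
    then show "w \<in> insert 1 (?f ` {1..k} \<union> (+) k ` ({1..m} - {x}))"
    proof cases
      case 2
      then show ?thesis by (intro insertI2 UnI1 image_eqI[of _ _ "w - 1"]) auto
    next
      case 3
      then show ?thesis using k by (intro insertI2 UnI1 image_eqI[of _ _ k]) auto
    next
      case 4
      then show ?thesis using w by (intro insertI2 UnI2 image_eqI[of _ _ "w - k"]) auto
    qed simp
  qed (use k x in \<open>auto split: if_splits\<close>)
next
  fix h :: "nat \<Rightarrow> nat" and A x y a c
  assume mono: "strict_mono_on A h" and "x \<in> A" "y \<in> A" "a \<in> A" "c \<in> A"
  then show "pattern_3412_4312 (h x) (h y) (h a) (h c) \<longleftrightarrow> pattern_3412_4312 x y a c"
    using inj_on_eq_iff[OF strict_mono_on_imp_inj_on[OF mono]]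
    by (simp add: strict_mono_on_less_iff[OF mono])
next
  fix us vs :: "nat list"
  let ?M = "Max (set us)" and ?k = "length us"
  assume perm: "perm (us @ 1 # vs)" and us: "us \<noteq> []"
    and fits: "\<And>u v. u \<in> set us \<Longrightarrow> v \<in> set vs \<Longrightarrow> u \<noteq> ?M \<longrightarrow> u < v"
    and "?k < ?M"
  have M: "?M \<in> set us" "\<And>u. u \<in> set us \<Longrightarrow> u \<le> ?M" using us by simp_all
  have dist: "distinct (us @ 1 # vs)" using perm by (simp add: perm_def)
  have gt: "1 < y" if "y \<in> set us \<union> set vs" for y
  proof -
    have "0 < y" "y \<noteq> 1" using perm_pos[OF perm, of y] that dist by auto
    then show ?thesis by simp
  qed
  \<comment> \<open>Every letter of \<open>?A\<close> is smaller than every letter of \<open>?B\<close>, so \<open>?A\<close> is an initial segment.\<close>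
  let ?A = "insert 1 (set us - {?M})" and ?B = "insert ?M (set vs)"
  have "?A \<union> ?B = {1..length (us @ 1 # vs)}" using perm M(1) by (auto simp: perm_def)
  moreover have "a < b" if "a \<in> ?A" "b \<in> ?B" for a b
    using that gt[of b] M fits[of a b] by (auto simp: less_le)
  ultimately have "?A = {1..card ?A}" by (rule initial_segment_eq)
  moreover have "card ?A = ?k"
    using dist M(1) us by (simp add: distinct_card)
  ultimately have A: "?A = {1..?k}" by simp
  have "set us = insert ?M {2..?k}"
  proof -
    have "set us - {?M} = ?A - {1}" using dist by auto
    also have "\<dots> = {2..?k}" unfolding A by auto
    finally show ?thesis using M(1) by blast
  qed
  moreover have "(\<lambda>a. if a < ?k then a + 1 else ?k + (?M - ?k)) ` {1..?k} = insert ?M {2..?k}"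
    (is "?f ` _ = _")
  proof (intro equalityI subsetI)
    fix w assume "w \<in> insert ?M {2..?k}"
    then consider "w = ?M" | "2 \<le> w" "w \<le> ?k" by fastforce
    then show "w \<in> ?f ` {1..?k}"
    proof cases
      case 1
      then show ?thesis
        using \<open>?k < ?M\<close> us by (intro image_eqI[of _ _ ?k]) (simp_all add: Suc_le_eq)
    next
      case 2
      then show ?thesis by (intro image_eqI[of _ _ "w - 1"]) auto
    qed
  qed (use \<open>?k < ?M\<close> in \<open>auto split: if_splits\<close>)
  ultimately show "set us = ?f ` {1..?k}" by simp
qed (auto simp: strict_mono_on_def split: if_splits)

section \<open>Pattern containment through the order of occurrence\<close>

lemma contains_pattern_4_iff:
  assumes dist: "distinct \<pi>"
  shows "contains_pattern \<pi> [s\<^sub>1, s\<^sub>2, s\<^sub>3, s\<^sub>4] \<longleftrightarrow>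
    (\<exists>a b c d. before \<pi> a b \<and> before \<pi> b c \<and> before \<pi> c d \<and>
       (a < b \<longleftrightarrow> s\<^sub>1 < s\<^sub>2) \<and> (a < c \<longleftrightarrow> s\<^sub>1 < s\<^sub>3) \<and> (a < d \<longleftrightarrow> s\<^sub>1 < s\<^sub>4) \<and>
       (b < c \<longleftrightarrow> s\<^sub>2 < s\<^sub>3) \<and> (b < d \<longleftrightarrow> s\<^sub>2 < s\<^sub>4) \<and> (c < d \<longleftrightarrow> s\<^sub>3 < s\<^sub>4))"
    (is "_ \<longleftrightarrow> (\<exists>a b c d. ?occ a b c d)")
proof
  let ?\<sigma> = "[s\<^sub>1, s\<^sub>2, s\<^sub>3, s\<^sub>4]"
  have \<sigma>: "letter ?\<sigma> 1 = s\<^sub>1" "letter ?\<sigma> 2 = s\<^sub>2" "letter ?\<sigma> 3 = s\<^sub>3" "letter ?\<sigma> 4 = s\<^sub>4"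
    by (simp_all add: letter_def)
  have four: "{1..length ?\<sigma>} = {1, 2, 3, 4}" by auto
  {
    assume "contains_pattern \<pi> ?\<sigma>"
    then obtain j where j: "strict_mono_on {1..length ?\<sigma>} j" "j ` {1..length ?\<sigma>} \<subseteq> {1..length \<pi>}"
      and cmp: "\<And>a b. 1 \<le> a \<and> a < b \<and> b \<le> length ?\<sigma> \<Longrightarrow>
        letter \<pi> (j a) < letter \<pi> (j b) \<longleftrightarrow> letter ?\<sigma> a < letter ?\<sigma> b"
      unfolding contains_pattern_def by metis
    have "before \<pi> (letter \<pi> (j k)) (letter \<pi> (j l))"
      if "k \<in> {1, 2, 3, 4}" "l \<in> {1, 2, 3, 4}" "k < l" for k l
    proof -
      have "j k < j l" using strict_mono_onD[OF j(1), of k l] that unfolding four by simp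
      moreover have "j k \<in> {1..length \<pi>}" "j l \<in> {1..length \<pi>}" using j(2) that unfolding four by blast+
      ultimately show ?thesis unfolding letter_def by (subst before_nth[OF dist]) auto
    qed
    then have "?occ (letter \<pi> (j 1)) (letter \<pi> (j 2)) (letter \<pi> (j 3)) (letter \<pi> (j 4))"
      using cmp[of 1 2] cmp[of 1 3] cmp[of 1 4] cmp[of 2 3] cmp[of 2 4] cmp[of 3 4] unfolding \<sigma>
      by simp
    then show "\<exists>a b c d. ?occ a b c d" by blast
  next
    assume "\<exists>a b c d. ?occ a b c d"
    then obtain a b c d where occ: "?occ a b c d" by blast
    then have "a \<in> set \<pi>" "b \<in> set \<pi>" "c \<in> set \<pi>" "d \<in> set \<pi>"
      using before_in_set[of \<pi> a b] before_in_set[of \<pi> c d] by simp_all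
    then obtain i\<^sub>1 i\<^sub>2 i\<^sub>3 i\<^sub>4 where i: "i\<^sub>1 < length \<pi>" "\<pi> ! i\<^sub>1 = a" "i\<^sub>2 < length \<pi>" "\<pi> ! i\<^sub>2 = b"
      "i\<^sub>3 < length \<pi>" "\<pi> ! i\<^sub>3 = c" "i\<^sub>4 < length \<pi>" "\<pi> ! i\<^sub>4 = d"
      unfolding in_set_conv_nth by blast
    have less: "i\<^sub>1 < i\<^sub>2" "i\<^sub>2 < i\<^sub>3" "i\<^sub>3 < i\<^sub>4"
      using occ before_nth[OF dist i(1,3)] before_nth[OF dist i(3,5)] before_nth[OF dist i(5,7)]
      unfolding i(2,4,6,8) by blast+
    define j where "j k = (if k = 1 then Suc i\<^sub>1 else if k = 2 then Suc i\<^sub>2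
        else if k = 3 then Suc i\<^sub>3 else Suc i\<^sub>4)"
      for k :: nat
    have letters: "letter \<pi> (j 1) = a" "letter \<pi> (j 2) = b" "letter \<pi> (j 3) = c" "letter \<pi> (j 4) = d"
      using i by (simp_all add: letter_def j_def)
    show "contains_pattern \<pi> ?\<sigma>" unfolding contains_pattern_def
    proof (intro exI conjI allI impI)
      show "strict_mono_on {1..length ?\<sigma>} j"
        unfolding four using less by (auto simp: strict_mono_on_def j_def)
      show "j ` {1..length ?\<sigma>} \<subseteq> {1..length \<pi>}"
        unfolding four using i by (auto simp: j_def)
      fix k l assume "1 \<le> k \<and> k < l \<and> l \<le> length ?\<sigma>"
      then consider "k = 1" "l = 2" | "k = 1" "l = 3" | "k = 1" "l = 4" | "k = 2" "l = 3"
        | "k = 2" "l = 4" | "k = 3" "l = 4" by fastforce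
      then show "letter \<pi> (j k) < letter \<pi> (j l) \<longleftrightarrow> letter ?\<sigma> k < letter ?\<sigma> l"
        using occ by cases (simp_all only: letters \<sigma>)
    qed
  }
qed

lemma chain_distinct:
  assumes "distinct \<pi>" "before \<pi> a b" "before \<pi> b c" "before \<pi> c d"
  shows "a \<noteq> b" "a \<noteq> c" "a \<noteq> d" "b \<noteq> c" "b \<noteq> d" "c \<noteq> d"
  using assms before_trans[OF assms(1)] before_irrefl[OF assms(1)] by metis+

text \<open>Letters at different places of a permutation differ, so the six comparisons can be replaced by an
equivalent chain of strict inequalities \<open>Q\<close>.\<close>

lemma contains_pattern_4_iff_order:
  assumes dist: "distinct \<pi>"
    and order: "\<And>a b c d :: nat. a \<noteq> b \<Longrightarrow> a \<noteq> c \<Longrightarrow> a \<noteq> d \<Longrightarrow> b \<noteq> c \<Longrightarrow> b \<noteq> d \<Longrightarrow> c \<noteq> d \<Longrightarrow>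
      (a < b \<longleftrightarrow> s\<^sub>1 < s\<^sub>2) \<and> (a < c \<longleftrightarrow> s\<^sub>1 < s\<^sub>3) \<and> (a < d \<longleftrightarrow> s\<^sub>1 < s\<^sub>4) \<and>
      (b < c \<longleftrightarrow> s\<^sub>2 < s\<^sub>3) \<and> (b < d \<longleftrightarrow> s\<^sub>2 < s\<^sub>4) \<and> (c < d \<longleftrightarrow> s\<^sub>3 < s\<^sub>4) \<longleftrightarrow> Q a b c d"
  shows "contains_pattern \<pi> [s\<^sub>1, s\<^sub>2, s\<^sub>3, s\<^sub>4] \<longleftrightarrow>
    (\<exists>a b c d. before \<pi> a b \<and> before \<pi> b c \<and> before \<pi> c d \<and> Q a b c d)"
  unfolding contains_pattern_4_iff[OF dist]
proof (intro arg_cong[of _ _ Ex] ext conj_cong refl)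
  fix a b c d assume "before \<pi> a b" "before \<pi> b c" "before \<pi> c d"
  from chain_distinct[OF dist this]
  show "((a < b \<longleftrightarrow> s\<^sub>1 < s\<^sub>2) \<and> (a < c \<longleftrightarrow> s\<^sub>1 < s\<^sub>3) \<and> (a < d \<longleftrightarrow> s\<^sub>1 < s\<^sub>4) \<and>
      (b < c \<longleftrightarrow> s\<^sub>2 < s\<^sub>3) \<and> (b < d \<longleftrightarrow> s\<^sub>2 < s\<^sub>4) \<and> (c < d \<longleftrightarrow> s\<^sub>3 < s\<^sub>4)) = Q a b c d"
    by (rule order)
qed

lemma separable_iff_avoids:
  assumes "distinct \<pi>"
  shows "separable \<pi> \<longleftrightarrow> \<not> contains_pattern \<pi> [2, 4, 1, 3] \<and> \<not> contains_pattern \<pi> [3, 1, 4, 2]"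
proof -
  have "contains_pattern \<pi> [2, 4, 1, 3] \<longleftrightarrow>
      (\<exists>a b c d. before \<pi> a b \<and> before \<pi> b c \<and> before \<pi> c d \<and> c < a \<and> a < d \<and> d < b)"
    by (rule contains_pattern_4_iff_order[OF assms]) auto
  moreover have "contains_pattern \<pi> [3, 1, 4, 2] \<longleftrightarrow>
      (\<exists>a b c d. before \<pi> a b \<and> before \<pi> b c \<and> before \<pi> c d \<and> b < d \<and> d < a \<and> a < c)"
    by (rule contains_pattern_4_iff_order[OF assms]) auto
  ultimately show ?thesis unfolding separable_def by blast
qed

text \<open>Which of the two patterns occurs depends on the order in which \<open>x\<close> and \<open>y\<close> occur.\<close>

lemma pattern_2413_4213_av_iff_avoids:
  assumes dist: "distinct \<pi>"
  shows "pattern_2413_4213.av \<pi> \<longleftrightarrow> \<not> contains_pattern \<pi> [2, 4, 1, 3] \<and> \<not> contains_pattern \<pi> [4, 2, 1, 3]"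
proof -
  have 1: "contains_pattern \<pi> [2, 4, 1, 3] \<longleftrightarrow>
      (\<exists>x y a c. before \<pi> x y \<and> before \<pi> y a \<and> before \<pi> a c \<and> pattern_2413_4213 x y a c)"
    by (rule contains_pattern_4_iff_order[OF dist]) auto
  have 2: "contains_pattern \<pi> [4, 2, 1, 3] \<longleftrightarrow>
      (\<exists>y x a c. before \<pi> y x \<and> before \<pi> x a \<and> before \<pi> a c \<and> pattern_2413_4213 x y a c)"
    by (rule contains_pattern_4_iff_order[OF dist]) auto
  have total: "before \<pi> x y \<or> before \<pi> y x"
    if "before \<pi> x a" "before \<pi> y a" "pattern_2413_4213 x y a c" for x y a c
    using that before_in_set[OF that(1)] before_in_set[OF that(2)] by (intro before_total) auto
  show ?thesis
    unfolding pattern_2413_4213.av_def 1 2 using total before_trans[OF dist] by blast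
qed

text \<open>The condition is symmetric in \<open>x\<close> and \<open>y\<close>, so one may assume \<open>x < y\<close>; the order in which they occur
then decides between the two patterns.\<close>

lemma pattern_3412_4312_av_iff_avoids:
  assumes dist: "distinct \<pi>"
  shows "pattern_3412_4312.av \<pi> \<longleftrightarrow> \<not> contains_pattern \<pi> [3, 4, 1, 2] \<and> \<not> contains_pattern \<pi> [4, 3, 1, 2]"
proof -
  have 1: "contains_pattern \<pi> [3, 4, 1, 2] \<longleftrightarrow>
      (\<exists>x y a c. before \<pi> x y \<and> before \<pi> y a \<and> before \<pi> a c \<and> a < c \<and> c < x \<and> x < y)"
    by (rule contains_pattern_4_iff_order[OF dist]) auto
  have 2: "contains_pattern \<pi> [4, 3, 1, 2] \<longleftrightarrow>
      (\<exists>y x a c. before \<pi> y x \<and> before \<pi> x a \<and> before \<pi> a c \<and> a < c \<and> c < x \<and> x < y)"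
    by (rule contains_pattern_4_iff_order[OF dist]) auto
  show ?thesis
  proof
    assume av: "pattern_3412_4312.av \<pi>"
    show "\<not> contains_pattern \<pi> [3, 4, 1, 2] \<and> \<not> contains_pattern \<pi> [4, 3, 1, 2]"
      unfolding 1 2
    proof (intro conjI notI; elim exE conjE)
      fix x y a c
      assume "before \<pi> x y" "before \<pi> y a" "before \<pi> a c" "a < c" "c < x" "x < y"
      then show False
        using pattern_3412_4312.avD[OF av before_trans[OF dist, of x y a], of y c] by auto
    next
      fix x y a c
      assume "before \<pi> y x" "before \<pi> x a" "before \<pi> a c" "a < c" "c < x" "x < y"
      then show False
        using pattern_3412_4312.avD[OF av _ before_trans[OF dist, of y x a], of x c] by auto
    qed
  next
    assume none: "\<not> contains_pattern \<pi> [3, 4, 1, 2] \<and> \<not> contains_pattern \<pi> [4, 3, 1, 2]"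
    have False
      if "before \<pi> x a" "before \<pi> y a" "before \<pi> a c" "pattern_3412_4312 x y a c" "x < y" for x y a c
    proof -
      have "before \<pi> x y \<or> before \<pi> y x"
        using that(5) before_in_set[OF that(1)] before_in_set[OF that(2)] by (intro before_total) auto
      then show False using none that unfolding 1 2 by blast
    qed
    then show "pattern_3412_4312.av \<pi>" unfolding pattern_3412_4312.av_def by (metis linorder_neqE_nat)
  qed
qed

lemma avoiders_eq:
  assumes "\<And>\<pi>. distinct \<pi> \<Longrightarrow> av \<pi> \<longleftrightarrow> \<not> contains_pattern \<pi> \<sigma> \<and> \<not> contains_pattern \<pi> \<tau>"
  shows "avoiders n {\<sigma>, \<tau>} = {\<pi>. perm \<pi> \<and> av \<pi> \<and> length \<pi> = n}"
proof -
  have "\<pi> \<in> permutations_of_set {1..n} \<longleftrightarrow> perm \<pi> \<and> length \<pi> = n" for \<pi>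
  proof -
    have "length \<pi> = n" if "distinct \<pi>" "set \<pi> = {1..n}" using distinct_card[OF that(1)] that(2) by simp
    then show ?thesis unfolding permutations_of_set_def perm_def mem_Collect_eq by blast
  qed
  moreover have "(\<forall>\<rho>\<in>{\<sigma>, \<tau>}. \<not> contains_pattern \<pi> \<rho>) \<longleftrightarrow> av \<pi>" if "perm \<pi>" for \<pi>
    using assms[of \<pi>] that by (simp add: perm_def)
  ultimately show ?thesis unfolding avoiders_def by blast
qed

theorem theorem5p6:
  fixes P :: "nat list set" and t r p :: "'a::field" and z S T R Q :: "'a fls"
  assumes "P \<in> {{[2,4,1,3], [3,1,4,2]}, {[2,4,1,3], [4,2,1,3]}, {[3,4,1,2], [4,3,1,2]}}"
    and "r \<noteq> 0" and "p \<noteq> 0"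
  defines "z \<equiv> fls_X" and "T \<equiv> fls_const t" and "R \<equiv> fls_const r" and "Q \<equiv> fls_const p"
    and "S \<equiv> fps_to_fls (gf_avoiders P t 1 1) - 1"
  shows "gf_avoiders_tilde P t r p =
           ((1 / z + 1 - R - Q) * S + (1 - R) * (1 - Q) * S ^ 2) /
           ((1 - R * Q * z) * (1 + (1 - Q) * S) * (1 + (1 - R) * S))
       \<and> S = z + (1 + T) * z * S + T * z * S ^ 2 + T * S ^ 3"
proof -
  consider "P = {[2,4,1,3], [3,1,4,2]}" | "P = {[2,4,1,3], [4,2,1,3]}" | "P = {[3,4,1,2], [4,3,1,2]}"
    using assms(1) by blast
  then show ?thesis
  proof cases
    case 1
    then have "avoiders n P = {\<pi> \<in> separable.members. length \<pi> = n}" for n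
      using avoiders_eq[OF separable_iff_avoids] by (simp add: separable.members_def conj_assoc)
    note gf = separable.generating_function[OF assms(2,3) this separable_factorization
        separable_skew_equation]
    show ?thesis
      unfolding z_def T_def R_def Q_def S_def gf(3) by (intro conjI) (rule gf(1), rule gf(2))
  next
    case 2
    then have "avoiders n P = {\<pi> \<in> pattern_2413_4213.members. length \<pi> = n}" for n
      using avoiders_eq[OF pattern_2413_4213_av_iff_avoids] by (simp add: pattern_2413_4213.members_def conj_assoc)
    note gf = pattern_2413_4213.generating_function[OF assms(2,3) this pattern_2413_4213.glue_factorization
        pattern_2413_4213.tail_equation]
    show ?thesis
      unfolding z_def T_def R_def Q_def S_def gf(3) by (intro conjI) (rule gf(1), rule gf(2))
  next
    case 3
    then have "avoiders n P = {\<pi> \<in> pattern_3412_4312.members. length \<pi> = n}" for n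
      using avoiders_eq[OF pattern_3412_4312_av_iff_avoids] by (simp add: pattern_3412_4312.members_def conj_assoc)
    note gf = pattern_3412_4312.generating_function[OF assms(2,3) this pattern_3412_4312.glue_factorization
        pattern_3412_4312.tail_equation]
    show ?thesis
      unfolding z_def T_def R_def Q_def S_def gf(3) by (intro conjI) (rule gf(1), rule gf(2))
  qed
qed

end
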